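(* Every instance of EndOfMeteredLine can be mapped in linear time to an instance of EndOfPotentialLine such that from any solution of the latter a solution of the former can be constructed in linear time.
   Context: EndOfMeteredLine: given Boolean circuits $S,P:\{0,1\}^n\to\{0,1\}^n$ and $V:\{0,1\}^n\to\{0,\dots,2^n\}$ such that $P(0^n)=0^n\ne S(0^n)$ and $V(0^n)=1$, find $x\in\{0,1\}^n$ satisfying one of: (T1) $S(P(x))\ne x\ne 0^n$ or $P(S(x))\ne x$; (T2) $x\ne 0^n$ and $V(x)=1$; (T3) either $V(x)>0$ and $V(S(x))-V(x)\ne 1$, or $V(x)>1$ and $V(x)-V(P(x))\ne 1$. EndOfPotentialLine: given Boolean circuits $S,P:\{0,1\}^n\to\{0,1\}^n$ with $P(0^n)=0^n\ne S(0^n)$ and a Boolean circuit $V:\{0,1\}^n\to\{0,1,\dots,2^m-1\}$ with $V(0^n)=0$, find one of: (R1) $x\in\{0,1\}^n$ with $S(P(x))\ne x\ne 0^n$ or $P(S(x))\ne x$; (R2) $x\in\{0,1\}^n$ with $x\ne S(x)$, $P(S(x))=x$ and $V(S(x))-V(x)\le 0$. Time bounds are in terms of the size of the input circuits. *)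

theory Defs
  imports Main
begin

section \<open>Boolean circuits\<close>

text \<open>
  A circuit is a straight-line program over the wires \<open>0, 1, 2, \<dots>\<close>: the first \<open>num_inputs\<close> wires
  carry the input bits, and gate number \<open>j\<close> drives wire \<open>num_inputs + j\<close> and may read only wires of
  smaller index.
\<close>

datatype gate =
    Const_Gate bool
  | Not_Gate nat
  | And_Gate nat nat
  | Or_Gate nat nat

record circuit =
  num_inputs :: nat
  gates :: "gate list"
  outputs :: "nat list"

fun gate_args :: "gate \<Rightarrow> nat set" where
  "gate_args (Const_Gate b) = {}"
| "gate_args (Not_Gate i) = {i}"
| "gate_args (And_Gate i j) = {i, j}"
| "gate_args (Or_Gate i j) = {i, j}"

fun gate_value :: "bool list \<Rightarrow> gate \<Rightarrow> bool" where
  "gate_value w (Const_Gate b) = b"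
| "gate_value w (Not_Gate i) = (\<not> w ! i)"
| "gate_value w (And_Gate i j) = (w ! i \<and> w ! j)"
| "gate_value w (Or_Gate i j) = (w ! i \<or> w ! j)"

definition circuit_wires :: "circuit \<Rightarrow> bool list \<Rightarrow> bool list" where
  "circuit_wires C x = foldl (\<lambda>w g. w @ [gate_value w g]) x (gates C)"

definition circuit_eval :: "circuit \<Rightarrow> bool list \<Rightarrow> bool list" where
  "circuit_eval C x = map (\<lambda>i. circuit_wires C x ! i) (outputs C)"

definition is_circuit :: "circuit \<Rightarrow> nat \<Rightarrow> nat \<Rightarrow> bool" where
  "is_circuit C n m \<longleftrightarrow>
     num_inputs C = n \<and> length (outputs C) = m \<and>
     (\<forall>j < length (gates C). \<forall>i \<in> gate_args (gates C ! j). i < n + j) \<and>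
     (\<forall>i \<in> set (outputs C). i < n + length (gates C))"

definition circuit_size :: "circuit \<Rightarrow> nat" where
  "circuit_size C = num_inputs C + length (gates C) + length (outputs C)"

text \<open>A circuit with numerical values outputs the binary expansion, least significant bit first.\<close>

definition circuit_number :: "circuit \<Rightarrow> bool list \<Rightarrow> int" where
  "circuit_number C x = horner_sum of_bool 2 (circuit_eval C x)"


section \<open>The two search problems\<close>

record line_instance =
  dim :: nat
  succ_circuit :: circuit
  pred_circuit :: circuit
  value_circuit :: circuit

abbreviation cube :: "nat \<Rightarrow> bool list set" where
  "cube n \<equiv> {x. length x = n}"

abbreviation zeros :: "nat \<Rightarrow> bool list" where
  "zeros n \<equiv> replicate n False"

abbreviation succ_of :: "line_instance \<Rightarrow> bool list \<Rightarrow> bool list" where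
  "succ_of I \<equiv> circuit_eval (succ_circuit I)"

abbreviation pred_of :: "line_instance \<Rightarrow> bool list \<Rightarrow> bool list" where
  "pred_of I \<equiv> circuit_eval (pred_circuit I)"

abbreviation value_of :: "line_instance \<Rightarrow> bool list \<Rightarrow> int" where
  "value_of I \<equiv> circuit_number (value_circuit I)"

definition instance_size :: "line_instance \<Rightarrow> nat" where
  "instance_size I =
     circuit_size (succ_circuit I) + circuit_size (pred_circuit I) + circuit_size (value_circuit I)"

text \<open>The range \<open>{0, \<dots>, 2^n}\<close> of the meter needs \<open>n + 1\<close> output bits.\<close>

definition metered_line_instance :: "line_instance \<Rightarrow> bool" where
  "metered_line_instance I \<longleftrightarrow>
     is_circuit (succ_circuit I) (dim I) (dim I) \<and>
     is_circuit (pred_circuit I) (dim I) (dim I) \<and>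
     is_circuit (value_circuit I) (dim I) (dim I + 1) \<and>
     (\<forall>x \<in> cube (dim I). value_of I x \<le> 2 ^ dim I) \<and>
     pred_of I (zeros (dim I)) = zeros (dim I) \<and>
     zeros (dim I) \<noteq> succ_of I (zeros (dim I)) \<and>
     value_of I (zeros (dim I)) = 1"

definition metered_line_solution :: "line_instance \<Rightarrow> bool list \<Rightarrow> bool" where
  "metered_line_solution I x \<longleftrightarrow>
     x \<in> cube (dim I) \<and>
     (((succ_of I (pred_of I x) \<noteq> x \<and> x \<noteq> zeros (dim I)) \<or> pred_of I (succ_of I x) \<noteq> x) \<or>
      (x \<noteq> zeros (dim I) \<and> value_of I x = 1) \<or>
      ((value_of I x > 0 \<and> value_of I (succ_of I x) - value_of I x \<noteq> 1) \<or>
       (value_of I x > 1 \<and> value_of I x - value_of I (pred_of I x) \<noteq> 1)))"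

definition potential_line_instance :: "line_instance \<Rightarrow> bool" where
  "potential_line_instance I \<longleftrightarrow>
     is_circuit (succ_circuit I) (dim I) (dim I) \<and>
     is_circuit (pred_circuit I) (dim I) (dim I) \<and>
     (\<exists>m. is_circuit (value_circuit I) (dim I) m) \<and>
     pred_of I (zeros (dim I)) = zeros (dim I) \<and>
     zeros (dim I) \<noteq> succ_of I (zeros (dim I)) \<and>
     value_of I (zeros (dim I)) = 0"

definition potential_line_solution :: "line_instance \<Rightarrow> bool list \<Rightarrow> bool" where
  "potential_line_solution I x \<longleftrightarrow>
     x \<in> cube (dim I) \<and>
     (((succ_of I (pred_of I x) \<noteq> x \<and> x \<noteq> zeros (dim I)) \<or> pred_of I (succ_of I x) \<noteq> x) \<or>
      (x \<noteq> succ_of I x \<and> pred_of I (succ_of I x) = x \<and>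
       value_of I (succ_of I x) - value_of I x \<le> 0))"


section \<open>Random access machines\<close>

text \<open>
  A word RAM with finitely many accessible registers (named by the program) and an indirectly
  addressed memory. A state is the pair of the register contents and the memory contents. The only
  arithmetic is addition and truncated subtraction.
\<close>

datatype ram =
    Load_Const nat nat
  | Add nat nat nat
  | Sub nat nat nat
  | Load nat nat
  | Store nat nat
  | Seq ram ram
  | If_Less nat nat ram ram
  | While_Less nat nat ram

type_synonym ram_state = "(nat \<Rightarrow> nat) \<times> (nat \<Rightarrow> nat)"

text \<open>
  \<open>ram_exec B c s t s'\<close>: started in \<open>s\<close>, the program \<open>c\<close> halts in \<open>s'\<close> after exactly \<open>t\<close> unit-cost
  steps, and no word exceeding \<open>B\<close> is ever written. Without such a bound the unit cost of arithmetic
  on unbounded numbers would be unrealistic.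
\<close>

inductive ram_exec :: "nat \<Rightarrow> ram \<Rightarrow> ram_state \<Rightarrow> nat \<Rightarrow> ram_state \<Rightarrow> bool" for B :: nat where
  Load_Const: "k \<le> B \<Longrightarrow> ram_exec B (Load_Const r k) (R, M) 1 (R(r := k), M)"
| Add: "R a + R b \<le> B \<Longrightarrow> ram_exec B (Add r a b) (R, M) 1 (R(r := R a + R b), M)"
| Sub: "R a - R b \<le> B \<Longrightarrow> ram_exec B (Sub r a b) (R, M) 1 (R(r := R a - R b), M)"
| Load: "M (R a) \<le> B \<Longrightarrow> ram_exec B (Load r a) (R, M) 1 (R(r := M (R a)), M)"
| Store: "R r \<le> B \<Longrightarrow> ram_exec B (Store a r) (R, M) 1 (R, M(R a := R r))"
| Seq: "ram_exec B c1 s1 t1 s2 \<Longrightarrow> ram_exec B c2 s2 t2 s3 \<Longrightarrow>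
    ram_exec B (Seq c1 c2) s1 (t1 + t2) s3"
| If_True: "fst s a < fst s b \<Longrightarrow> ram_exec B c1 s t s' \<Longrightarrow>
    ram_exec B (If_Less a b c1 c2) s (t + 1) s'"
| If_False: "\<not> fst s a < fst s b \<Longrightarrow> ram_exec B c2 s t s' \<Longrightarrow>
    ram_exec B (If_Less a b c1 c2) s (t + 1) s'"
| While_True: "fst s1 a < fst s1 b \<Longrightarrow> ram_exec B c s1 t1 s2 \<Longrightarrow>
    ram_exec B (While_Less a b c) s2 t2 s3 \<Longrightarrow>
    ram_exec B (While_Less a b c) s1 (t1 + t2 + 1) s3"
| While_False: "\<not> fst s a < fst s b \<Longrightarrow> ram_exec B (While_Less a b c) s 1 s"

text \<open>
  The input occupies the memory cells from address \<open>0\<close> on, and register \<open>1\<close> holds its length.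
  The output is the block of memory that starts at the address in register \<open>0\<close> and whose length is
  in register \<open>1\<close>.
\<close>

definition ram_input :: "nat list \<Rightarrow> ram_state" where
  "ram_input xs = ((\<lambda>_. 0)(1 := length xs), (\<lambda>i. if i < length xs then xs ! i else 0))"

definition ram_output :: "ram_state \<Rightarrow> nat list" where
  "ram_output s = (case s of (R, M) \<Rightarrow> map M [R 0 ..< R 0 + R 1])"

text \<open>
  Computability in linear time with words of \<open>log N + O(1)\<close> bits, where \<open>N\<close> is the value of \<open>size_of\<close>
  on the argument; \<open>D\<close> is the set of admissible arguments.
\<close>

definition linear_time_computable ::
  "'a set \<Rightarrow> ('a \<Rightarrow> nat) \<Rightarrow> ('a \<Rightarrow> nat list) \<Rightarrow> ('b \<Rightarrow> nat list) \<Rightarrow> ('a \<Rightarrow> 'b) \<Rightarrow> bool"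
where
  "linear_time_computable D size_of enc_in enc_out f \<longleftrightarrow>
     (\<exists>c k. \<forall>x \<in> D. \<exists>t s.
        ram_exec (k * size_of x) c (ram_input (enc_in x)) t s \<and>
        t \<le> k * size_of x \<and> ram_output s = enc_out (f x))"


section \<open>Encodings\<close>

fun enc_gate :: "gate \<Rightarrow> nat list" where
  "enc_gate (Const_Gate b) = [0, of_bool b, 0]"
| "enc_gate (Not_Gate i) = [1, i, 0]"
| "enc_gate (And_Gate i j) = [2, i, j]"
| "enc_gate (Or_Gate i j) = [3, i, j]"

definition enc_circuit :: "circuit \<Rightarrow> nat list" where
  "enc_circuit C =
     [num_inputs C, length (gates C), length (outputs C)] @ concat (map enc_gate (gates C)) @ outputs C"

definition enc_instance :: "line_instance \<Rightarrow> nat list" where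
  "enc_instance I =
     dim I # enc_circuit (succ_circuit I) @ enc_circuit (pred_circuit I) @ enc_circuit (value_circuit I)"

definition enc_bits :: "bool list \<Rightarrow> nat list" where
  "enc_bits x = length x # map of_bool x"

definition enc_instance_bits :: "line_instance \<times> bool list \<Rightarrow> nat list" where
  "enc_instance_bits p = enc_instance (fst p) @ enc_bits (snd p)"

end

(*
  Every vertex x with V(x) = 0 is turned into an isolated self-loop, and the potential is V, except
  that the value 1 is lowered to 0.  On the remaining vertices succ, pred are unchanged, so a violation
  at x in the new instance already is a violation at x in the old one: if V(S(x)) = 0 or V(P(x)) = 0
  while V(x) > 0, then x is of type T2 or T3.  Solutions are therefore mapped back by the identity.

  The new circuits share one gate list: the three given circuits with their internal wires
  renumbered, a disjunction over the output bits of V, and a multiplexer for each output bit of S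
  and P.  The machine appends its output to its input, so the memory always is the image of a growing
  list.  The machine for the solutions only has to locate its answer, the tail of its input.
*)
theory Submission
  imports Defs
begin

section \<open>A weakest precondition calculus for the machine\<close>

text \<open>Vertices of meter 0 have to be cut off because T3 restricts \<open>V(S(x))\<close> only
  where \<open>V(x) > 0\<close>; an edge leaving such a vertex could violate R2 without yielding any
  metered solution. The start vertex forces a change of values, since its meter 1 must become
  potential 0. Subtracting 1 everywhere would need a borrow chain; clearing the lowest bit when all
  higher bits are 0 needs one further gate, and the step from 1 to 2 merely becomes a step from 0 to
  2. Sharing the gate list costs a constant factor in size, but then a single routine,
  \<open>emit_gates\<close>, has to be verified, and the circuits differ only in their outputs. On
  the machine side the obstacle is the word bound \<open>B\<close>: each written word must be shown
  to respect it, so the loop lemmas carry bounds on addresses and wire numbers. Multiples such as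
  three times a gate count come from repeated addition, as the machine cannot multiply.\<close>

definition wp :: "nat \<Rightarrow> ram \<Rightarrow> (nat \<Rightarrow> ram_state \<Rightarrow> bool) \<Rightarrow> ram_state \<Rightarrow> bool" where
  "wp B c Q s \<longleftrightarrow> (\<exists>t s'. ram_exec B c s t s' \<and> Q t s')"

lemma wp_mono: "wp B c Q s \<Longrightarrow> (\<And>t s'. Q t s' \<Longrightarrow> Q' t s') \<Longrightarrow> wp B c Q' s"
  unfolding wp_def by blast

inductive_cases Load_Const_E: "ram_exec B (Load_Const r k) s t s'"
inductive_cases Add_E: "ram_exec B (Add r a b) s t s'"
inductive_cases Sub_E: "ram_exec B (Sub r a b) s t s'"
inductive_cases Load_E: "ram_exec B (Load r a) s t s'"
inductive_cases Store_E: "ram_exec B (Store a r) s t s'"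
inductive_cases Seq_E: "ram_exec B (Seq c d) s t s'"
inductive_cases If_E: "ram_exec B (If_Less a b c d) s t s'"

text \<open>Equivalences let the simplifier execute straight-line code symbolically, with one
  inequality left for each written word. Loops are absent because they need an invariant.\<close>

lemma wp_simps [simp]:
  "wp B (Load_Const r k) Q (R, M) \<longleftrightarrow> k \<le> B \<and> Q 1 (R(r := k), M)"
  "wp B (Add r a b) Q (R, M) \<longleftrightarrow> R a + R b \<le> B \<and> Q 1 (R(r := R a + R b), M)"
  "wp B (Sub r a b) Q (R, M) \<longleftrightarrow> R a - R b \<le> B \<and> Q 1 (R(r := R a - R b), M)"
  "wp B (Load r a) Q (R, M) \<longleftrightarrow> M (R a) \<le> B \<and> Q 1 (R(r := M (R a)), M)"
  "wp B (Store a r) Q (R, M) \<longleftrightarrow> R r \<le> B \<and> Q 1 (R, M(R a := R r))"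
  "wp B (Seq c d) Q s \<longleftrightarrow> wp B c (\<lambda>t. wp B d (\<lambda>u. Q (t + u))) s"
  "wp B (If_Less a b c d) Q (R, M) \<longleftrightarrow>
     (if R a < R b then wp B c (\<lambda>t. Q (t + 1)) (R, M) else wp B d (\<lambda>t. Q (t + 1)) (R, M))"
  unfolding wp_def
  subgoal by (fastforce elim: Load_Const_E intro: ram_exec.Load_Const)
  subgoal by (fastforce elim: Add_E intro: ram_exec.Add)
  subgoal by (fastforce elim: Sub_E intro: ram_exec.Sub)
  subgoal by (fastforce elim: Load_E intro: ram_exec.Load)
  subgoal by (fastforce elim: Store_E intro: ram_exec.Store)
  subgoal by (blast elim: Seq_E intro: ram_exec.Seq)
  subgoal by (cases "R a < R b") (fastforce elim: If_E intro: ram_exec.If_True ram_exec.If_False)+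
  done

text \<open>The number \<open>m\<close> of rounds is fixed in advance and the invariant is indexed
  by the rounds already done, so termination and cost come together: a round pays at most
  \<open>T\<close> plus one test, and the final test pays 1.\<close>

lemma wp_while:
  assumes "I 0 s"
    and step: "\<And>i R M. i < m \<Longrightarrow> I i (R, M) \<Longrightarrow>
                 R a < R b \<and> wp B c (\<lambda>t s'. t \<le> T \<and> I (Suc i) s') (R, M)"
    and exit: "\<And>R M. I m (R, M) \<Longrightarrow> \<not> R a < R b"
  shows "wp B (While_Less a b c) (\<lambda>t s'. t \<le> m * (T + 1) + 1 \<and> I m s') s"
proof -
  \<comment> \<open>Induction on the number \<open>k\<close> of rounds still to come, so that the
    base case is the exit.\<close>
  have "wp B (While_Less a b c) (\<lambda>t s'. t \<le> k * (T + 1) + 1 \<and> I m s') s"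
    if "k \<le> m" "I (m - k) s" for k s
    using that
  proof (induction k arbitrary: s)
    case 0
    then show ?case
      using exit[of "fst s" "snd s"] unfolding wp_def
      by (intro exI[of _ 1] exI[of _ s]) (use ram_exec.While_False[of s a b B c] in auto)
  next
    case (Suc k)
    have lt: "fst s a < fst s b"
      and "wp B c (\<lambda>t s'. t \<le> T \<and> I (Suc (m - Suc k)) s') s"
      using step[of "m - Suc k" "fst s" "snd s"] Suc.prems by auto
    then obtain t1 s1 where 1: "ram_exec B c s t1 s1" "t1 \<le> T" "I (m - k) s1"
      using Suc.prems unfolding wp_def by (auto simp: Suc_diff_Suc)
    obtain t2 s2 where "ram_exec B (While_Less a b c) s1 t2 s2" "t2 \<le> k * (T + 1) + 1" "I m s2"
      using Suc.IH[of s1] 1 Suc.prems unfolding wp_def by auto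
    with 1 lt show ?case
      unfolding wp_def
      by (intro exI[of _ "t1 + t2 + 1"] exI[of _ s2]) (use ram_exec.While_True[of s a b B c t1 s1 t2 s2] in auto)
  qed
  from this[of m] show ?thesis using assms(1) by simp
qed

text \<open>The padding by 0 agrees with the initial memory of \<open>ram_input\<close>. A store at
  address \<open>length xs\<close> then is an append, and reads below that address are
  unaffected.\<close>

definition mem :: "nat list \<Rightarrow> nat \<Rightarrow> nat" where
  "mem xs i = (if i < length xs then xs ! i else 0)"

lemma mem_append [simp]: "i < length xs \<Longrightarrow> mem (xs @ ys) i = mem xs i"
  by (simp add: mem_def nth_append)

lemma mem_snoc: "(mem xs)(length xs := v) = mem (xs @ [v])"
  by (auto simp: mem_def nth_append fun_eq_iff)

text \<open>Registers up to \<open>16\<close> hold addresses, offsets and constants that are fixed once the input has been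
  read; the predicate \<open>env\<close> below relies on this split.\<close>

abbreviation (input) r_len :: nat where "r_len \<equiv> 1"
abbreviation (input) r_one :: nat where "r_one \<equiv> 2"
abbreviation (input) r_dim :: nat where "r_dim \<equiv> 3"
abbreviation (input) r_aS :: nat where "r_aS \<equiv> 4"
abbreviation (input) r_eS :: nat where "r_eS \<equiv> 5"
abbreviation (input) r_aP :: nat where "r_aP \<equiv> 6"
abbreviation (input) r_eP :: nat where "r_eP \<equiv> 7"
abbreviation (input) r_aV :: nat where "r_aV \<equiv> 8"
abbreviation (input) r_eV :: nat where "r_eV \<equiv> 9"
abbreviation (input) r_zero :: nat where "r_zero \<equiv> 10"
abbreviation (input) r_offP :: nat where "r_offP \<equiv> 11"
abbreviation (input) r_offV :: nat where "r_offV \<equiv> 12"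
abbreviation (input) r_base :: nat where "r_base \<equiv> 13"
abbreviation (input) r_gates :: nat where "r_gates \<equiv> 14"
abbreviation (input) r_two :: nat where "r_two \<equiv> 15"
abbreviation (input) r_three :: nat where "r_three \<equiv> 16"
abbreviation (input) r_out :: nat where "r_out \<equiv> 17"
abbreviation (input) r_src :: nat where "r_src \<equiv> 18"
abbreviation (input) r_lim :: nat where "r_lim \<equiv> 19"
abbreviation (input) r_off :: nat where "r_off \<equiv> 20"
abbreviation (input) r_tag :: nat where "r_tag \<equiv> 21"
abbreviation (input) r_x :: nat where "r_x \<equiv> 22"
abbreviation (input) r_y :: nat where "r_y \<equiv> 23"
abbreviation (input) r_wire :: nat where "r_wire \<equiv> 24"
abbreviation (input) r_pos :: nat where "r_pos \<equiv> 25"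
abbreviation (input) r_neg :: nat where "r_neg \<equiv> 26"
abbreviation (input) r_idx :: nat where "r_idx \<equiv> 27"
abbreviation (input) r_junk :: nat where "r_junk \<equiv> 28"

text \<open>The machine has no empty instruction; the empty block writes a register that is never
  read, which accounts for one extra step per block.\<close>

fun block :: "ram list \<Rightarrow> ram" where
  "block [] = Load_Const r_junk 0"
| "block (c # cs) = Seq c (block cs)"

definition emit :: "nat list \<Rightarrow> ram" where
  "emit rs = block (concat (map (\<lambda>r. [Store r_out r, Add r_out r_out r_one]) rs))"

text \<open>Each word costs a store and an increment, and the closing empty block adds 1.
  \<open>r_out\<close> is barred from \<open>rs\<close> because it changes between the
  stores.\<close>

lemma wp_emit [simp]:
  assumes "R r_out = length l" "R r_one = 1" "r_out \<notin> set rs"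
    "\<forall>r \<in> set rs. R r \<le> B" "length l + length rs \<le> B"
  shows "wp B (emit rs) Q (R, mem l) \<longleftrightarrow>
    Q (2 * length rs + 1) (R(r_out := length l + length rs, r_junk := 0), mem (l @ map R rs))"
  using assms unfolding emit_def
proof (induction rs arbitrary: R l Q)
  case Nil
  then have "R(r_out := length l, r_junk := 0) = R(r_junk := 0)" by auto
  then show ?case by (simp del: fun_upd_apply)
next
  case (Cons r rs)
  define R' where "R' = R(r_out := Suc (length l))"
  have R': "R' r_out = Suc (length l)" "R' r_one = 1" "\<forall>r\<in>set rs. R' r \<le> B" "map R' rs = map R rs"
    "R'(r_out := k) = R(r_out := k)" for k
    using Cons.prems by (auto simp: R'_def)
  have "wp B (emit (r # rs)) Q (R, mem l) \<longleftrightarrow>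
      wp B (emit rs) (\<lambda>t. Q (Suc (Suc t))) (R', mem (l @ [R r]))"
    using Cons.prems by (simp add: emit_def mem_snoc R'_def)
  then show ?case
    using Cons.prems R' Cons.IH[of R' "l @ [R r]" "\<lambda>t. Q (Suc (Suc t))"]
    by (simp add: emit_def cong: map_cong)
qed

text \<open>Renumbering for a circuit placed behind \<open>d\<close> other gates: the input wires
  are shared, the gate wires move.\<close>

definition shift_wire :: "nat \<Rightarrow> nat \<Rightarrow> nat \<Rightarrow> nat" where
  "shift_wire n d i = (if i < n then i else i + d)"

text \<open>Adding the zero register is a no-op that makes both branches equally long.\<close>

definition shift_reg :: "nat \<Rightarrow> ram" where
  "shift_reg r = If_Less r r_dim (Add r r r_zero) (Add r r r_off)"

lemma wp_shift_reg [simp]: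
  assumes "R r_zero = 0" "R r + R r_off \<le> B"
  shows "wp B (shift_reg r) Q (R, M) \<longleftrightarrow>
    Q 2 (R(r := shift_wire (R r_dim) (R r_off) (R r)), M)"
  using assms by (auto simp: shift_reg_def shift_wire_def numeral_2_eq_2)

section \<open>The loops of the reduction program\<close>

text \<open>Cell 0 holds the dimension and each circuit opens with three header words, so the gates
  of S start at 4. For each circuit \<open>a\<close> marks the first gate and \<open>e\<close> the
  end of the gates, which is the first output.\<close>

definition pos_eS :: "line_instance \<Rightarrow> nat" where
  "pos_eS I = 4 + 3 * length (gates (succ_circuit I))"
definition pos_aP :: "line_instance \<Rightarrow> nat" where
  "pos_aP I = pos_eS I + dim I + 3"
definition pos_eP :: "line_instance \<Rightarrow> nat" where
  "pos_eP I = pos_aP I + 3 * length (gates (pred_circuit I))"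
definition pos_aV :: "line_instance \<Rightarrow> nat" where
  "pos_aV I = pos_eP I + dim I + 3"
definition pos_eV :: "line_instance \<Rightarrow> nat" where
  "pos_eV I = pos_aV I + 3 * length (gates (value_circuit I))"
definition off_P :: "line_instance \<Rightarrow> nat" where
  "off_P I = length (gates (succ_circuit I))"
definition off_V :: "line_instance \<Rightarrow> nat" where
  "off_V I = off_P I + length (gates (pred_circuit I))"
definition base :: "line_instance \<Rightarrow> nat" where
  "base I = dim I + off_V I + length (gates (value_circuit I))"
text \<open>The extra gates are \<open>dim I + 4\<close> for the tests on V and
  \<open>3 * dim I\<close> for each of the two multiplexers.\<close>

definition gate_count :: "line_instance \<Rightarrow> nat" where
  "gate_count I = off_V I + length (gates (value_circuit I)) + 7 * dim I + 4"

definition env :: "line_instance \<Rightarrow> (nat \<Rightarrow> nat) \<Rightarrow> bool" where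
  "env I R \<longleftrightarrow> R r_len = pos_eV I + dim I + 1 \<and> R r_one = 1 \<and> R r_dim = dim I \<and> R r_aS = 4 \<and>
     R r_eS = pos_eS I \<and> R r_aP = pos_aP I \<and> R r_eP = pos_eP I \<and> R r_aV = pos_aV I \<and>
     R r_eV = pos_eV I \<and> R r_zero = 0 \<and> R r_offP = off_P I \<and> R r_offV = off_V I \<and>
     R r_base = base I \<and> R r_gates = gate_count I \<and> R r_two = 2 \<and> R r_three = 3"

lemma env_upd [simp]: "r > 16 \<Longrightarrow> env I (R(r := v)) = env I R"
  by (simp add: env_def)

definition emitted :: "line_instance \<Rightarrow> nat list \<Rightarrow> ram_state \<Rightarrow> bool" where
  "emitted I l s \<longleftrightarrow> snd s = mem l \<and> env I (fst s) \<and> fst s r_out = length l"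

lemma emitted_Pair: "emitted I l (R, M) \<longleftrightarrow> M = mem l \<and> env I R \<and> R r_out = length l"
  by (simp add: emitted_def)

lemma envD:
  assumes "env I R"
  shows "R r_one = 1" "R (Suc 0) = pos_eV I + dim I + 1" "R r_dim = dim I" "R r_aS = 4" "R r_eS = pos_eS I"
    "R r_aP = pos_aP I" "R r_eP = pos_eP I" "R r_aV = pos_aV I" "R r_eV = pos_eV I" "R r_zero = 0"
    "R r_offP = off_P I" "R r_offV = off_V I" "R r_base = base I" "R r_gates = gate_count I"
    "R r_two = 2" "R r_three = 3"
  using assms by (simp_all add: env_def)

section \<open>Copying gates with renumbered wires\<close>

fun shift_gate :: "nat \<Rightarrow> nat \<Rightarrow> gate \<Rightarrow> gate" where
  "shift_gate n d (Const_Gate b) = Const_Gate b"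
| "shift_gate n d (Not_Gate i) = Not_Gate (shift_wire n d i)"
| "shift_gate n d (And_Gate i j) = And_Gate (shift_wire n d i) (shift_wire n d j)"
| "shift_gate n d (Or_Gate i j) = Or_Gate (shift_wire n d i) (shift_wire n d j)"

lemma length_enc_gate [simp]: "length (enc_gate g) = 3"
  by (cases g) auto

abbreviation enc_gates :: "gate list \<Rightarrow> nat list" where
  "enc_gates gs \<equiv> concat (map enc_gate gs)"

lemma length_enc_gates [simp]: "length (enc_gates gs) = 3 * length gs"
  by (induction gs) auto

lemma shift_wire_le: "shift_wire n d i \<le> i + d"
  by (simp add: shift_wire_def)

definition gate_loop :: ram where
  "gate_loop = While_Less r_src r_lim (block
     [Load r_tag r_src, Add r_src r_src r_one, Load r_x r_src, Add r_src r_src r_one,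
      Load r_y r_src, Add r_src r_src r_one,
      If_Less r_zero r_tag (block [shift_reg r_x, shift_reg r_y]) (block []),
      emit [r_tag, r_x, r_y]])"

text \<open>All reads stay below \<open>length l\<close>, so the words appended by the loop never
  disturb its input.\<close>

lemma wp_gate_loop:
  assumes "emitted I l (R, M)" "R r_src = a" "R r_lim = a + 3 * length gs" "R r_off = d"
    and input: "\<And>j. j < length gs \<Longrightarrow>
      [mem l (a + 3 * j), mem l (a + 3 * j + 1), mem l (a + 3 * j + 2)] = enc_gate (gs ! j)"
    and len: "a + 3 * length gs \<le> length l"
    and B: "length l + 3 * length gs < B" "3 \<le> B" 
    and args: "\<And>j i. j < length gs \<Longrightarrow> i \<in> gate_args (gs ! j) \<Longrightarrow> i + d < B"
    and "dim I > 0"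
  shows "wp B gate_loop
    (\<lambda>t s. t \<le> 30 * length gs + 1 \<and> emitted I (l @ enc_gates (map (shift_gate (dim I) d) gs)) s) (R, M)"
proof -
  let ?n = "dim I"
  define out where "out i = enc_gates (map (\<lambda>j. shift_gate ?n d (gs ! j)) [0..<i])" for i
  define inv where "inv i s \<longleftrightarrow> emitted I (l @ out i) s \<and> fst s r_src = a + 3 * i \<and>
    fst s r_lim = a + 3 * length gs \<and> fst s r_off = d" for i s
  have len_out: "length (out i) = 3 * i" for i unfolding out_def by (simp only: length_enc_gates length_map) simp
  \<comment> \<open>A round takes at most 20 steps; 29 is a loose bound that makes 30 together with
    the loop test.\<close>
  have "wp B gate_loop (\<lambda>t s. t \<le> length gs * (29 + 1) + 1 \<and> inv (length gs) s) (R, M)"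
    unfolding gate_loop_def
  proof (rule wp_while)
    show "inv 0 (R, M)" using assms by (simp add: inv_def out_def)
  next
    fix i R M assume i: "i < length gs" and inv: "inv i (R, M)"
    let ?l = "l @ out i"
    have R: "M = mem ?l" "env I R" "R r_out = length ?l" "R r_src = a + 3 * i"
        "R r_lim = a + 3 * length gs" "R r_off = d"
      using inv by (auto simp: inv_def emitted_Pair)
    have lt: "a + 3 * i + 2 < length l" using i len by simp
    have reads: "mem ?l (a + 3 * i) = enc_gate (gs ! i) ! 0"
      "mem ?l (Suc (a + 3 * i)) = enc_gate (gs ! i) ! 1"
      "mem ?l (Suc (Suc (a + 3 * i))) = enc_gate (gs ! i) ! 2"
      using lt input[OF i, symmetric] by auto
    have outs: "out (Suc i) = out i @ enc_gate (shift_gate ?n d (gs ! i))"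
      by (simp add: out_def)
    have le: "3 * i + 3 \<le> 3 * length gs" using i by simp
    \<comment> \<open>A constant has tag 0 and its first operand is a bit, not a wire; hence the
      test of the tag before the shift.\<close>
    obtain t x y where e: "enc_gate (gs ! i) = [t, x, y]" "t \<le> B" "x \<le> B" "y \<le> B"
      and es: "enc_gate (shift_gate ?n d (gs ! i)) =
        (if 0 < t then [t, shift_wire ?n d x, shift_wire ?n d y] else [t, x, y])"
      and xy: "0 < t \<Longrightarrow> x + d \<le> B" "0 < t \<Longrightarrow> y + d \<le> B"
    proof (cases "gs ! i")
      case (Const_Gate b)
      with that[of 0 "of_bool b" 0] B show ?thesis by (cases b) auto
    next
      case (Not_Gate j)
      with that[of 1 j 0] B args[OF i, of j] \<open>dim I > 0\<close> show ?thesis by (auto simp: shift_wire_def)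
    next
      case (And_Gate j k)
      with that[of 2 j k] B args[OF i, of j] args[OF i, of k] show ?thesis by auto
    next
      case (Or_Gate j k)
      with that[of 3 j k] B args[OF i, of j] args[OF i, of k] show ?thesis by auto
    qed
    have sh: "shift_wire ?n d x \<le> B" "shift_wire ?n d y \<le> B" if "0 < t"
      using xy[OF that] e(3,4) by (auto simp: shift_wire_def)
    show "R r_src < R r_lim \<and> wp B (block
     [Load r_tag r_src, Add r_src r_src r_one, Load r_x r_src, Add r_src r_src r_one,
      Load r_y r_src, Add r_src r_src r_one,
      If_Less r_zero r_tag (block [shift_reg r_x, shift_reg r_y]) (block []),
      emit [r_tag, r_x, r_y]]) (\<lambda>t s'. t \<le> 29 \<and> inv (Suc i) s') (R, M)"
      using e sh xy B lt le i R envD[OF R(2)]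
      by (cases "0 < t") (simp_all add: reads inv_def emitted_Pair outs len_out es)
  next
    fix R M assume "inv (length gs) (R, M)"
    then show "\<not> R r_src < R r_lim" by (simp add: inv_def)
  qed
  moreover have "map (\<lambda>j. shift_gate ?n d (gs ! j)) [0..<length gs] = map (shift_gate ?n d) gs"
    by (rule nth_equalityI) auto
  then have "out (length gs) = enc_gates (map (shift_gate ?n d) gs)"
    unfolding out_def by (simp only:)
  ultimately show ?thesis by (auto simp: inv_def elim!: wp_mono)
qed


section \<open>Generating disjunctions, multiplexers and output lists\<close>

definition or_loop :: ram where
  "or_loop = While_Less r_src r_lim (block
     [Load r_x r_src, Add r_src r_src r_one, shift_reg r_x,
      emit [r_three, r_wire, r_x], Add r_wire r_wire r_one])"

text \<open>A running disjunction: if wire \<open>w\<close> is False and these gates drive the wires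
  from \<open>w + 1\<close> on, then wire \<open>w + i\<close> is the disjunction of the first
  \<open>i\<close> wires \<open>p j\<close>.\<close>

definition or_gates :: "nat \<Rightarrow> (nat \<Rightarrow> nat) \<Rightarrow> nat \<Rightarrow> gate list" where
  "or_gates w p k = map (\<lambda>j. Or_Gate (w + j) (p j)) [0..<k]"

lemma length_or_gates [simp]: "length (or_gates w p k) = k"
  by (simp add: or_gates_def)

lemma wp_or_loop:
  assumes "emitted I l (R, M)" "R r_src = a" "R r_lim = a + k" "R r_off = d" "R r_wire = w"
    and input: "\<And>j. j < k \<Longrightarrow> mem l (a + j) = p j"
    and len: "a + k \<le> length l"
    and B: "length l + 3 * k < B" "3 \<le> B" "w + k \<le> B"
    and args: "\<And>j. j < k \<Longrightarrow> p j + d < B"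
  shows "wp B or_loop
    (\<lambda>t s. t \<le> 20 * k + 1 \<and> emitted I (l @ enc_gates (or_gates w (\<lambda>j. shift_wire (dim I) d (p j)) k)) s \<and>
      fst s r_wire = w + k) (R, M)"
proof -
  let ?n = "dim I"
  define out where "out i = enc_gates (or_gates w (\<lambda>j. shift_wire (dim I) d (p j)) i)" for i
  define inv where "inv i s \<longleftrightarrow> emitted I (l @ out i) s \<and> fst s r_src = a + i \<and>
    fst s r_lim = a + k \<and> fst s r_off = d \<and> fst s r_wire = w + i" for i s
  have len_out: "length (out i) = 3 * i" for i unfolding out_def by (simp only: length_enc_gates) simp
  have "wp B or_loop (\<lambda>t s. t \<le> k * (19 + 1) + 1 \<and> inv k s) (R, M)"
    unfolding or_loop_def
  proof (rule wp_while)
    show "inv 0 (R, M)" using assms by (simp add: inv_def out_def or_gates_def)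
  next
    fix i R M assume i: "i < k" and inv: "inv i (R, M)"
    let ?l = "l @ out i"
    have R: "M = mem ?l" "env I R" "R r_out = length ?l" "R r_src = a + i"
        "R r_lim = a + k" "R r_off = d" "R r_wire = w + i"
      using inv by (auto simp: inv_def emitted_Pair)
    have lt: "a + i < length l" using i len by simp
    have reads: "mem ?l (a + i) = p i"
      using lt input[OF i, symmetric] by auto
    have outs: "out (Suc i) = out i @ [3, w + i, shift_wire ?n d (p i)]"
      by (simp add: out_def or_gates_def)
    have sh: "shift_wire ?n d (p i) \<le> B" using args[OF i] by (simp add: shift_wire_def)
    show "R r_src < R r_lim \<and> wp B (block
     [Load r_x r_src, Add r_src r_src r_one, shift_reg r_x,
      emit [r_three, r_wire, r_x], Add r_wire r_wire r_one]) (\<lambda>t s'. t \<le> 19 \<and> inv (Suc i) s') (R, M)"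
      using sh args[OF i] B lt i R envD[OF R(2)]
      by (auto simp: reads inv_def emitted_Pair outs len_out)
  next
    fix R M assume "inv k (R, M)"
    then show "\<not> R r_src < R r_lim" by (simp add: inv_def)
  qed
  then show ?thesis by (auto simp: inv_def out_def elim!: wp_mono)
qed

text \<open>\<open>r_idx\<close> is at once the loop counter and the input wire fed to the second
  conjunction.\<close>

definition mux_loop :: ram where
  "mux_loop = While_Less r_idx r_dim (block
     [Load r_x r_src, Add r_src r_src r_one, shift_reg r_x, Add r_y r_wire r_one,
      emit [r_two, r_pos, r_x, r_two, r_neg, r_idx, r_three, r_wire, r_y],
      Add r_wire r_wire r_three, Add r_idx r_idx r_one])"

text \<open>With \<open>z'\<close> the negation of \<open>z\<close>, every third gate selects wire
  \<open>p j\<close> if \<open>z\<close> holds and input wire \<open>j\<close> otherwise;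
  \<open>w\<close> is the wire of the first gate.\<close>

definition mux_gates :: "nat \<Rightarrow> nat \<Rightarrow> nat \<Rightarrow> (nat \<Rightarrow> nat) \<Rightarrow> nat \<Rightarrow> gate list" where
  "mux_gates z z' w p k = concat (map (\<lambda>j.
     [And_Gate z (p j), And_Gate z' j, Or_Gate (w + 3 * j) (w + 3 * j + 1)]) [0..<k])"

lemma length_mux_gates [simp]: "length (mux_gates z z' w p k) = 3 * k"
  by (induction k) (simp_all add: mux_gates_def)

lemma wp_mux_loop:
  assumes "emitted I l (R, M)" "R r_src = a" "R r_idx = 0" "R r_off = d" "R r_wire = w"
    "R r_pos = z" "R r_neg = z'"
    and input: "\<And>j. j < dim I \<Longrightarrow> mem l (a + j) = p j"
    and len: "a + dim I \<le> length l"
    and B: "length l + 9 * dim I < B" "3 \<le> B" "w + 3 * dim I < B" "z \<le> B" "z' \<le> B"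
    and args: "\<And>j. j < dim I \<Longrightarrow> p j + d < B"
  shows "wp B mux_loop
    (\<lambda>t s. t \<le> 40 * dim I + 1 \<and>
      emitted I (l @ enc_gates (mux_gates z z' w (\<lambda>j. shift_wire (dim I) d (p j)) (dim I))) s \<and>
      fst s r_wire = w + 3 * dim I \<and> fst s r_pos = z \<and> fst s r_neg = z') (R, M)"
proof -
  let ?n = "dim I"
  define out where "out i = enc_gates (mux_gates z z' w (\<lambda>j. shift_wire (dim I) d (p j)) i)" for i
  define inv where "inv i s \<longleftrightarrow> emitted I (l @ out i) s \<and> fst s r_src = a + i \<and>
    fst s r_idx = i \<and> fst s r_off = d \<and> fst s r_wire = w + 3 * i \<and> fst s r_pos = z \<and> fst s r_neg = z'" for i s
  have len_out: "length (out i) = 9 * i" for i unfolding out_def by (simp only: length_enc_gates) simp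
  have "wp B mux_loop (\<lambda>t s. t \<le> ?n * (39 + 1) + 1 \<and> inv ?n s) (R, M)"
    unfolding mux_loop_def
  proof (rule wp_while)
    show "inv 0 (R, M)" using assms by (simp add: inv_def out_def mux_gates_def)
  next
    fix i R M assume i: "i < ?n" and inv: "inv i (R, M)"
    let ?l = "l @ out i"
    have R: "M = mem ?l" "env I R" "R r_out = length ?l" "R r_src = a + i"
        "R r_idx = i" "R r_off = d" "R r_wire = w + 3 * i" "R r_pos = z" "R r_neg = z'"
      using inv by (auto simp: inv_def emitted_Pair)
    have lt: "a + i < length l" using i len by simp
    have reads: "mem ?l (a + i) = p i"
      using lt input[OF i, symmetric] by auto
    have outs: "out (Suc i) = out i @
        [2, z, shift_wire ?n d (p i), 2, z', i, 3, w + 3 * i, w + 3 * i + 1]"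
      by (simp add: out_def mux_gates_def)
    have le: "3 * i + 3 \<le> 3 * ?n" using i by simp
    have sh: "shift_wire ?n d (p i) \<le> B" using args[OF i] by (simp add: shift_wire_def)
    show "R r_idx < R r_dim \<and> wp B (block
     [Load r_x r_src, Add r_src r_src r_one, shift_reg r_x, Add r_y r_wire r_one,
      emit [r_two, r_pos, r_x, r_two, r_neg, r_idx, r_three, r_wire, r_y],
      Add r_wire r_wire r_three, Add r_idx r_idx r_one]) (\<lambda>t s'. t \<le> 39 \<and> inv (Suc i) s') (R, M)"
      using sh args[OF i] B lt i le R envD[OF R(2)]
      by (auto simp: reads inv_def emitted_Pair outs len_out)
  next
    fix R M assume "inv ?n (R, M)"
    then show "\<not> R r_idx < R r_dim" by (auto simp: inv_def emitted_Pair dest: envD(3))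
  qed
  then show ?thesis by (auto simp: inv_def out_def elim!: wp_mono)
qed

text \<open>The selected bits leave the multiplexer on every third wire, hence the stride 3.\<close>

definition wires_loop :: ram where
  "wires_loop = While_Less r_idx r_dim (block
     [emit [r_wire], Add r_wire r_wire r_three, Add r_idx r_idx r_one])"

lemma wp_wires_loop:
  assumes "emitted I l (R, M)" "R r_idx = 0" "R r_wire = w"
    and B: "length l + dim I < B" "w + 3 * dim I < B"
  shows "wp B wires_loop
    (\<lambda>t s. t \<le> 10 * dim I + 1 \<and> emitted I (l @ map (\<lambda>j. w + 3 * j) [0..<dim I]) s) (R, M)"
proof -
  let ?n = "dim I"
  define inv where "inv i s \<longleftrightarrow> emitted I (l @ map (\<lambda>j. w + 3 * j) [0..<i]) s \<and>
    fst s r_idx = i \<and> fst s r_wire = w + 3 * i" for i s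
  have "wp B wires_loop (\<lambda>t s. t \<le> ?n * (9 + 1) + 1 \<and> inv ?n s) (R, M)"
    unfolding wires_loop_def
  proof (rule wp_while)
    show "inv 0 (R, M)" using assms by (simp add: inv_def)
  next
    fix i R M assume i: "i < ?n" and inv: "inv i (R, M)"
    let ?l = "l @ map (\<lambda>j. w + 3 * j) [0..<i]"
    have R: "M = mem ?l" "env I R" "R r_out = length ?l" "R r_idx = i" "R r_wire = w + 3 * i"
      using inv by (auto simp: inv_def emitted_Pair)
    have le: "3 * i + 3 \<le> 3 * ?n" using i by simp
    show "R r_idx < R r_dim \<and> wp B (block
     [emit [r_wire], Add r_wire r_wire r_three, Add r_idx r_idx r_one])
       (\<lambda>t s'. t \<le> 9 \<and> inv (Suc i) s') (R, M)"
      using B i le R envD[OF R(2)]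
      by (auto simp: inv_def emitted_Pair)
  next
    fix R M assume "inv ?n (R, M)"
    then show "\<not> R r_idx < R r_dim" by (auto simp: inv_def emitted_Pair dest: envD(3))
  qed
  then show ?thesis by (auto simp: inv_def elim!: wp_mono)
qed

definition copy_loop :: ram where
  "copy_loop = While_Less r_src r_lim (block
     [Load r_x r_src, Add r_src r_src r_one, shift_reg r_x, emit [r_x]])"

lemma wp_copy_loop:
  assumes "emitted I l (R, M)" "R r_src = a" "R r_lim = a + k" "R r_off = d"
    and input: "\<And>j. j < k \<Longrightarrow> mem l (a + j) = p j"
    and len: "a + k \<le> length l"
    and B: "length l + k < B"
    and args: "\<And>j. j < k \<Longrightarrow> p j + d < B"
  shows "wp B copy_loop
    (\<lambda>t s. t \<le> 20 * k + 1 \<and>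
       emitted I (l @ map (\<lambda>j. shift_wire (dim I) d (p j)) [0..<k]) s) (R, M)"
proof -
  let ?n = "dim I"
  let ?out = "\<lambda>i. map (\<lambda>j. shift_wire (dim I) d (p j)) [0..<i]"
  define inv where "inv i s \<longleftrightarrow> emitted I (l @ ?out i) s \<and> fst s r_src = a + i \<and>
    fst s r_lim = a + k \<and> fst s r_off = d" for i s
  have "wp B copy_loop (\<lambda>t s. t \<le> k * (19 + 1) + 1 \<and> inv k s) (R, M)"
    unfolding copy_loop_def
  proof (rule wp_while)
    show "inv 0 (R, M)" using assms by (simp add: inv_def)
  next
    fix i R M assume i: "i < k" and inv: "inv i (R, M)"
    let ?l = "l @ ?out i"
    have R: "M = mem ?l" "env I R" "R r_out = length ?l" "R r_src = a + i"
        "R r_lim = a + k" "R r_off = d"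
      using inv by (auto simp: inv_def emitted_Pair)
    have lt: "a + i < length l" using i len by simp
    have reads: "mem ?l (a + i) = p i"
      using lt input[OF i, symmetric] by auto
    have sh: "shift_wire ?n d (p i) \<le> B" using args[OF i] by (simp add: shift_wire_def)
    show "R r_src < R r_lim \<and> wp B (block
     [Load r_x r_src, Add r_src r_src r_one, shift_reg r_x, emit [r_x]])
       (\<lambda>t s'. t \<le> 19 \<and> inv (Suc i) s') (R, M)"
      using sh args[OF i] B lt i R envD[OF R(2)]
      by (auto simp: reads inv_def emitted_Pair)
  next
    fix R M assume "inv k (R, M)"
    then show "\<not> R r_src < R r_lim" by (simp add: inv_def)
  qed
  then show ?thesis by (auto simp: inv_def elim!: wp_mono)
qed

section \<open>The circuits of the potential instance\<close>

abbreviation run :: "gate list \<Rightarrow> bool list \<Rightarrow> bool list" where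
  "run gs w \<equiv> foldl (\<lambda>w g. w @ [gate_value w g]) w gs"

lemma run_extends: "\<exists>u. run gs w = w @ u \<and> length u = length gs"
  by (induction gs rule: rev_induct) auto

lemma length_run [simp]: "length (run gs w) = length w + length gs"
  by (induction gs rule: rev_induct) auto

lemma run_decomp: "run gs w = w @ drop (length w) (run gs w)"
  using run_extends[of w gs] by auto

text \<open>The gate condition of \<open>is_circuit\<close> relative to \<open>w\<close> wires
  already present; in this form it splits along concatenation.\<close>

definition wf_gates :: "nat \<Rightarrow> gate list \<Rightarrow> bool" where
  "wf_gates w gs \<longleftrightarrow> (\<forall>j < length gs. \<forall>i \<in> gate_args (gs ! j). i < w + j)"

lemma wf_gates_Nil [simp]: "wf_gates w []"
  by (simp add: wf_gates_def)

lemma wf_gates_append [simp]: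
  "wf_gates w (gs @ hs) \<longleftrightarrow> wf_gates w gs \<and> wf_gates (w + length gs) hs"
proof -
  have split: "(\<forall>j < a + b. P j) \<longleftrightarrow> (\<forall>j < a. P j) \<and> (\<forall>j < b. P (a + j))"
    for P :: "nat \<Rightarrow> bool" and a b
  proof safe
    fix j assume "\<forall>j < a. P j" "\<forall>j < b. P (a + j)" "j < a + b"
    then show "P j" by (cases "j < a") (auto dest: spec[of _ "j - a"])
  qed auto
  show ?thesis
    unfolding wf_gates_def length_append split by (simp add: nth_append add.assoc)
qed

lemma wf_gates_Cons [simp]:
  "wf_gates w (g # gs) \<longleftrightarrow> (\<forall>i \<in> gate_args g. i < w) \<and> wf_gates (Suc w) gs"
  using wf_gates_append[of w "[g]" gs] by (simp add: wf_gates_def)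

lemma gate_args_shift_gate [simp]: "gate_args (shift_gate n d g) = shift_wire n d ` gate_args g"
  by (cases g) auto

lemma wf_gates_shift: "wf_gates n gs \<Longrightarrow> wf_gates (n + d) (map (shift_gate n d) gs)"
  by (fastforce simp: wf_gates_def shift_wire_def)

lemma gate_value_shift:
  assumes "\<And>i. i \<in> gate_args g \<Longrightarrow> w' ! shift_wire n d i = w ! i"
  shows "gate_value w' (shift_gate n d g) = gate_value w g"
  using assms by (cases g) auto

lemma nth_shift_wire:
  "length x = n \<Longrightarrow> length u = d \<Longrightarrow> i < n + length v \<Longrightarrow>
     (x @ u @ v @ y) ! shift_wire n d i = (x @ v) ! i"
  by (auto simp: shift_wire_def nth_append)

text \<open>This makes circuits composable: behind any \<open>d\<close> foreign wires
  \<open>u\<close>, a renumbered gate reads the same values as before, so the run appends the same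
  bits.\<close>

lemma run_shift:
  assumes "wf_gates n gs" "length x = n" "length u = d"
  shows "run (map (shift_gate n d) gs) (x @ u) = x @ u @ drop n (run gs x)"
  using assms(1)
proof (induction gs rule: rev_induct)
  case Nil
  then show ?case using assms by simp
next
  case (snoc g gs)
  define v where "v = drop n (run gs x)"
  have v: "run gs x = x @ v" "length v = length gs"
    unfolding v_def assms(2)[symmetric] by (rule run_decomp) simp
  have "gate_value (x @ u @ v) (shift_gate n d g) = gate_value (x @ v) g"
    using snoc.prems nth_shift_wire[of x n u d _ v "[]"] assms v
    by (intro gate_value_shift) auto
  with snoc v assms show ?case by simp
qed

text \<open>The constant gate supplies the empty disjunction at index 0.\<close>

lemma run_or_gates:
  assumes "length w = m" "\<And>j. j < k \<Longrightarrow> p j < m"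
  shows "run (Const_Gate False # or_gates m p k) w = w @ map (\<lambda>i. \<exists>j<i. w ! p j) [0..<Suc k]"
  using assms(2)
proof (induction k)
  case 0
  then show ?case by (simp add: or_gates_def)
next
  case (Suc k)
  have "run (Const_Gate False # or_gates m p k) w = w @ map (\<lambda>i. \<exists>j<i. w ! p j) [0..<Suc k]"
    using Suc by simp
  moreover have "or_gates m p (Suc k) = or_gates m p k @ [Or_Gate (m + k) (p k)]"
    by (simp add: or_gates_def)
  moreover have "(\<exists>j<k. w ! p j) \<or> w ! p k \<longleftrightarrow> (\<exists>j<Suc k. w ! p j)"
    using less_Suc_eq by auto
  ultimately show ?case
    using Suc.prems[of k] assms(1) by (simp add: nth_append del: upt_Suc) simp
qed

lemma wf_or_gates: "(\<And>j. j < k \<Longrightarrow> p j \<le> m) \<Longrightarrow> wf_gates (Suc m) (or_gates m p k)"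
  by (force simp: wf_gates_def or_gates_def)

lemma mux_gates_Suc: "mux_gates z z' w p (Suc k) =
   mux_gates z z' w p k @ [And_Gate z (p k), And_Gate z' k, Or_Gate (w + 3 * k) (w + 3 * k + 1)]"
  by (simp add: mux_gates_def)

text \<open>Only the third wire of each group matters; the other two are intermediate conjunctions.
  All selected wires lie below \<open>m\<close>, so earlier groups do not affect later ones.\<close>

lemma run_mux_gates:
  assumes "length w = m" "\<And>j. j < k \<Longrightarrow> p j < m" "z < m" "z' < m" "k \<le> m"
  shows "\<exists>u. run (mux_gates z z' m p k) w = w @ u \<and> length u = 3 * k \<and>
    (\<forall>j<k. u ! (3 * j + 2) = (w ! z \<and> w ! p j \<or> w ! z' \<and> w ! j))"
  using assms(2,5)
proof (induction k)
  case 0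
  then show ?case by (simp add: mux_gates_def)
next
  case (Suc k)
  then obtain u where u: "run (mux_gates z z' m p k) w = w @ u" "length u = 3 * k"
    "\<forall>j<k. u ! (3 * j + 2) = (w ! z \<and> w ! p j \<or> w ! z' \<and> w ! j)"
    by auto
  let ?a = "w ! z \<and> w ! p k" and ?b = "w ! z' \<and> w ! k"
  have "run (mux_gates z z' m p (Suc k)) w = w @ (u @ [?a, ?b, ?a \<or> ?b])"
    using u(1,2) Suc.prems(1)[of k] Suc.prems(2) assms(1,3,4)
    by (simp add: mux_gates_Suc nth_append)
  moreover have "(u @ [?a, ?b, ?a \<or> ?b]) ! (3 * j + 2) = (w ! z \<and> w ! p j \<or> w ! z' \<and> w ! j)"
    if "j < Suc k" for j
    using that u(2,3) by (cases "j = k") (auto simp: nth_append)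
  ultimately show ?case using u(2) by (intro exI[of _ "u @ [?a, ?b, ?a \<or> ?b]"]) simp
qed

lemma wf_mux_gates:
  assumes "\<And>j. j < k \<Longrightarrow> p j < m" "z < m" "z' < m" "k \<le> m"
  shows "wf_gates m (mux_gates z z' m p k)"
  using assms(1,4) by (induction k) (use assms(2,3) in \<open>auto simp: mux_gates_Suc mux_gates_def[of _ _ _ _ 0] intro: trans_less_add1\<close>)

section \<open>Gates and outputs of the new instance\<close>

definition core_gates :: "line_instance \<Rightarrow> gate list" where
  "core_gates I = map (shift_gate (dim I) 0) (gates (succ_circuit I)) @
     map (shift_gate (dim I) (off_P I)) (gates (pred_circuit I)) @
     map (shift_gate (dim I) (off_V I)) (gates (value_circuit I))"

definition wire_S :: "line_instance \<Rightarrow> nat \<Rightarrow> nat" where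
  "wire_S I j = shift_wire (dim I) 0 (outputs (succ_circuit I) ! j)"
definition wire_P :: "line_instance \<Rightarrow> nat \<Rightarrow> nat" where
  "wire_P I j = shift_wire (dim I) (off_P I) (outputs (pred_circuit I) ! j)"
definition wire_V :: "line_instance \<Rightarrow> nat \<Rightarrow> nat" where
  "wire_V I j = shift_wire (dim I) (off_V I) (outputs (value_circuit I) ! j)"

text \<open>With \<open>b = base I\<close> and \<open>n = dim I\<close>, wire \<open>b + n\<close> carries \<open>V(x) > 1\<close>, wires \<open>b + n + 1\<close> and
  \<open>b + n + 2\<close> carry \<open>V(x) > 0\<close> and its negation, and wire \<open>b + n + 3\<close> is the corrected low bit
  of the potential.\<close>

definition test_gates :: "line_instance \<Rightarrow> gate list" where
  "test_gates I = Const_Gate False # or_gates (base I) (\<lambda>j. wire_V I (Suc j)) (dim I) @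
     [Or_Gate (base I + dim I) (wire_V I 0), Not_Gate (base I + dim I + 1),
      And_Gate (base I + dim I) (wire_V I 0)]"

definition select_gates :: "line_instance \<Rightarrow> nat \<Rightarrow> (nat \<Rightarrow> nat) \<Rightarrow> gate list" where
  "select_gates I w p = mux_gates (base I + dim I + 1) (base I + dim I + 2) w p (dim I)"

definition new_gates :: "line_instance \<Rightarrow> gate list" where
  "new_gates I = core_gates I @ test_gates I @
     select_gates I (base I + dim I + 4) (wire_S I) @
     select_gates I (base I + 4 * dim I + 4) (wire_P I)"

definition new_circuit :: "line_instance \<Rightarrow> nat list \<Rightarrow> circuit" where
  "new_circuit I os = \<lparr>num_inputs = dim I, gates = new_gates I, outputs = os\<rparr>"

text \<open>The first multiplexer starts at wire \<open>base I + dim I + 4\<close> and the selected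
  bit is the third wire of a group, which gives the offset 6; the second one starts
  \<open>3 * dim I\<close> wires later.\<close>

definition outs_S :: "line_instance \<Rightarrow> nat list" where
  "outs_S I = map (\<lambda>j. base I + dim I + 6 + 3 * j) [0..<dim I]"
definition outs_P :: "line_instance \<Rightarrow> nat list" where
  "outs_P I = map (\<lambda>j. base I + 4 * dim I + 6 + 3 * j) [0..<dim I]"
definition outs_V :: "line_instance \<Rightarrow> nat list" where
  "outs_V I = (base I + dim I + 3) # map (\<lambda>j. wire_V I (Suc j)) [0..<dim I]"

definition potential_of :: "line_instance \<Rightarrow> line_instance" where
  "potential_of I = \<lparr>dim = dim I, succ_circuit = new_circuit I (outs_S I),
     pred_circuit = new_circuit I (outs_P I), value_circuit = new_circuit I (outs_V I)\<rparr>"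

lemma length_core_gates: "dim I + length (core_gates I) = base I"
  by (simp add: core_gates_def base_def off_V_def off_P_def)

lemma length_test_gates: "length (test_gates I) = dim I + 4"
  by (simp add: test_gates_def)

lemma length_new_gates: "length (new_gates I) = gate_count I"
  using length_core_gates[of I]
  by (simp add: new_gates_def gate_count_def length_test_gates select_gates_def base_def)

lemma is_circuit_output: "is_circuit C n m \<Longrightarrow> j < m \<Longrightarrow> outputs C ! j < n + length (gates C)"
  unfolding is_circuit_def using nth_mem by blast

context
  fixes I n
  assumes met: "metered_line_instance I" and n: "dim I = n"
begin

lemma wf_S: "wf_gates n (gates (succ_circuit I))"
  and wf_P: "wf_gates n (gates (pred_circuit I))"
  and wf_V: "wf_gates n (gates (value_circuit I))"
  using met n by (auto simp: metered_line_instance_def is_circuit_def wf_gates_def)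

lemma outputs_S: "length (outputs (succ_circuit I)) = n"
    "j < n \<Longrightarrow> outputs (succ_circuit I) ! j < n + length (gates (succ_circuit I))"
  and outputs_P: "length (outputs (pred_circuit I)) = n"
    "j < n \<Longrightarrow> outputs (pred_circuit I) ! j < n + length (gates (pred_circuit I))"
  and outputs_V: "length (outputs (value_circuit I)) = Suc n"
    "j < Suc n \<Longrightarrow> outputs (value_circuit I) ! j < n + length (gates (value_circuit I))"
proof -
  have "is_circuit (succ_circuit I) n n" "is_circuit (pred_circuit I) n n"
    "is_circuit (value_circuit I) n (Suc n)"
    using met n by (simp_all add: metered_line_instance_def)
  note c = this
  show "length (outputs (succ_circuit I)) = n" "length (outputs (pred_circuit I)) = n"
    "length (outputs (value_circuit I)) = Suc n"
    "j < n \<Longrightarrow> outputs (succ_circuit I) ! j < n + length (gates (succ_circuit I))"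
    "j < n \<Longrightarrow> outputs (pred_circuit I) ! j < n + length (gates (pred_circuit I))"
    "j < Suc n \<Longrightarrow> outputs (value_circuit I) ! j < n + length (gates (value_circuit I))"
    using c by (simp_all add: is_circuit_def c[THEN is_circuit_output])
qed

lemma wire_less:
  "j < n \<Longrightarrow> wire_S I j < base I" "j < n \<Longrightarrow> wire_P I j < base I" "j < Suc n \<Longrightarrow> wire_V I j < base I"
  using outputs_S(2)[of j] outputs_P(2)[of j] outputs_V(2)[of j] n
  by (auto simp: wire_S_def wire_P_def wire_V_def shift_wire_def base_def off_P_def off_V_def)

lemma wf_new_gates: "wf_gates n (new_gates I)"
proof -
  have core: "wf_gates n (core_gates I)"
    using wf_gates_shift[OF wf_S, of 0] wf_gates_shift[OF wf_P, of "off_P I"]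
      wf_gates_shift[OF wf_V, of "off_V I"] n
    by (simp add: core_gates_def off_P_def off_V_def add.assoc)
  have le: "wire_V I j < base I + d" if "j < Suc n" for j d
    using wire_less(3)[OF that] by simp
  have "wf_gates (Suc (base I)) (or_gates (base I) (\<lambda>j. wire_V I (Suc j)) n)"
    using wire_less(3) by (intro wf_or_gates) (simp add: less_imp_le)
  then have test: "wf_gates (base I) (test_gates I)"
    using n le[of 0 "Suc n"] le[of 0 "Suc (Suc (Suc n))"] by (simp add: test_gates_def)
  have sel: "wf_gates w (select_gates I w p)" if "\<And>j. j < n \<Longrightarrow> p j < w" "base I + n + 4 \<le> w" for w p
    unfolding select_gates_def using that n by (intro wf_mux_gates) auto
  have "wf_gates (base I + dim I + 4) (select_gates I (base I + dim I + 4) (wire_S I))"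
    "wf_gates (base I + 4 * dim I + 4) (select_gates I (base I + 4 * dim I + 4) (wire_P I))"
    using n wire_less by (auto intro!: sel trans_less_add1)
  then show ?thesis using core test n length_core_gates[of I]
    by (simp add: new_gates_def length_test_gates select_gates_def) (simp add: algebra_simps)
qed

text \<open>The wires are followed through the stages: \<open>w\<close> after the three circuits,
  \<open>y'\<close> after the tests, then \<open>u\<close> and \<open>v\<close> appended by the
  multiplexers. Later stages only append, so each wire can be read off where it was
  produced.\<close>

lemma run_new_gates:
  assumes x: "length x = n"
  defines "W \<equiv> run (new_gates I) x"
  defines "b \<equiv> circuit_eval (value_circuit I) x"
  shows "j < n \<Longrightarrow> W ! (base I + n + 6 + 3 * j) =
           (if True \<in> set b then circuit_eval (succ_circuit I) x ! j else x ! j)" (is "_ \<Longrightarrow> ?S")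
    and "j < n \<Longrightarrow> W ! (base I + 4 * n + 6 + 3 * j) =
           (if True \<in> set b then circuit_eval (pred_circuit I) x ! j else x ! j)" (is "_ \<Longrightarrow> ?P")
    and "W ! (base I + n + 3) = (b ! 0 \<and> True \<in> set (tl b))"
    and "j < n \<Longrightarrow> W ! wire_V I (Suc j) = b ! Suc j" (is "_ \<Longrightarrow> ?V")
proof -
  define vS where "vS = drop n (run (gates (succ_circuit I)) x)"
  define vP where "vP = drop n (run (gates (pred_circuit I)) x)"
  define vV where "vV = drop n (run (gates (value_circuit I)) x)"
  define w where "w = x @ vS @ vP @ vV"
  have runs: "run (gates (succ_circuit I)) x = x @ vS" "run (gates (pred_circuit I)) x = x @ vP"
      "run (gates (value_circuit I)) x = x @ vV"
    unfolding vS_def vP_def vV_def by (rule run_decomp[of x, unfolded x])+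
  have lens: "length vS = off_P I" "length vS + length vP = off_V I" "length w = base I"
    using x n by (simp_all add: vS_def vP_def vV_def off_P_def off_V_def base_def w_def)
  \<comment> \<open>For each copied circuit the wires of its predecessors are the foreign segment of
    \<open>run_shift\<close>.\<close>
  have core: "run (core_gates I) x = w"
    using run_shift[OF wf_S x, of "[]" 0] run_shift[OF wf_P x, of vS] lens
      run_shift[OF wf_V x, of "vS @ vP"] n
    by (simp add: core_gates_def w_def vS_def[symmetric] vP_def[symmetric] vV_def[symmetric])
  have S: "w ! wire_S I j = circuit_eval (succ_circuit I) x ! j" if "j < n" for j
    using nth_shift_wire[of x n "[]" 0 "outputs (succ_circuit I) ! j" vS "vP @ vV"] that x lens n
      outputs_S(1) outputs_S(2)[OF that]
    by (simp add: w_def wire_S_def circuit_eval_def circuit_wires_def runs off_P_def)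
  have P: "w ! wire_P I j = circuit_eval (pred_circuit I) x ! j" if "j < n" for j
    using nth_shift_wire[of x n vS "off_P I" "outputs (pred_circuit I) ! j" vP vV] that x lens n
      outputs_P(1) outputs_P(2)[OF that]
    by (simp add: w_def wire_P_def circuit_eval_def circuit_wires_def runs off_V_def off_P_def)
  have V: "w ! wire_V I j = b ! j" if "j < Suc n" for j
    using nth_shift_wire[of x n "vS @ vP" "off_V I" "outputs (value_circuit I) ! j" vV "[]"] that x lens n
      outputs_V(1) outputs_V(2)[OF that]
    by (simp add: w_def wire_V_def circuit_eval_def circuit_wires_def runs base_def b_def)
  have len_b: "length b = Suc n" using outputs_V(1) by (simp add: b_def circuit_eval_def)
  \<comment> \<open>The bits come lowest first, so a True in \<open>tl b\<close> means that the
    meter exceeds 1.\<close>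
  have tl_b: "(\<exists>j<n. w ! wire_V I (Suc j)) \<longleftrightarrow> True \<in> set (tl b)"
    using V len_b by (auto simp: in_set_conv_nth nth_tl)
  have hd_b: "b ! 0 \<or> True \<in> set (tl b) \<longleftrightarrow> True \<in> set b"
    using len_b by (cases b) auto
  define h where "h = (True \<in> set (tl b))"
  define y where "y = w @ map (\<lambda>i. \<exists>j<i. w ! wire_V I (Suc j)) [0..<n]"
  have len_y: "length y = base I + n" using lens by (simp add: y_def)
  have "run (Const_Gate False # or_gates (base I) (\<lambda>j. wire_V I (Suc j)) n) w = y @ [h]"
    unfolding y_def h_def tl_b[symmetric]
    using run_or_gates[of w "base I" n "\<lambda>j. wire_V I (Suc j)"] lens wire_less(3) by simp
  moreover have "y ! wire_V I 0 = b ! 0"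
    using V[of 0] wire_less(3)[of 0] lens by (simp add: y_def nth_append)
  ultimately have test: "run (test_gates I) w = y @ [h, True \<in> set b, True \<notin> set b, b ! 0 \<and> h]"
    using hd_b len_y wire_less(3)[of 0] n
    by (auto simp: test_gates_def nth_append h_def)
  define y' where "y' = y @ [h, True \<in> set b, True \<notin> set b, b ! 0 \<and> h]"
  have y': "length y' = base I + n + 4" "y' ! (base I + n + 1) = (True \<in> set b)"
     "y' ! (base I + n + 2) = (True \<notin> set b)" "y' ! (base I + n + 3) = (b ! 0 \<and> h)"
    by (simp_all add: y'_def len_y nth_append)
  have y'w: "y' ! i = w ! i" if "i < base I" for i
    using that lens by (simp add: y'_def y_def nth_append)
  have y'x: "y' ! i = x ! i" if "i < n" for i
    using that x by (simp add: y'_def y_def w_def nth_append)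
  have nb: "n \<le> base I" using n by (simp add: base_def)
  obtain u where u: "run (select_gates I (base I + n + 4) (wire_S I)) y' = y' @ u" "length u = 3 * n"
    "\<forall>j<n. u ! (3 * j + 2) = (True \<in> set b \<and> y' ! wire_S I j \<or> True \<notin> set b \<and> y' ! j)"
    using run_mux_gates[of y' "base I + n + 4" n "wire_S I" "base I + n + 1" "base I + n + 2"]
      y' wire_less(1) nb n by (auto simp: select_gates_def trans_less_add1)
  have "length (y' @ u) = base I + 4 * n + 4" using u y' by simp
  moreover have "(y' @ u) ! (base I + n + 1) = (True \<in> set b)" "(y' @ u) ! (base I + n + 2) = (True \<notin> set b)"
    using y' by (simp_all add: nth_append)
  ultimately obtain v where v: "run (select_gates I (base I + 4 * n + 4) (wire_P I)) (y' @ u) = y' @ u @ v"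
    "length v = 3 * n"
    "\<forall>j<n. v ! (3 * j + 2) = (True \<in> set b \<and> (y' @ u) ! wire_P I j \<or> True \<notin> set b \<and> (y' @ u) ! j)"
    using run_mux_gates[of "y' @ u" "base I + 4 * n + 4" n "wire_P I" "base I + n + 1" "base I + n + 2"]
      wire_less(2) nb n by (auto simp: select_gates_def trans_less_add1)
  have W: "W = y' @ u @ v"
    using u v n by (simp add: W_def new_gates_def core test y'_def[symmetric])
  show ?S if "j < n"
  proof -
    have "W ! (base I + n + 6 + 3 * j) = (u @ v) ! (3 * j + 2)"
      using y' by (simp add: W nth_append)
    also have "\<dots> = u ! (3 * j + 2)" using u that by (simp add: nth_append)
    finally show ?thesis
      using u that S[OF that] y'w[OF wire_less(1)[OF that]] y'x[OF that] by auto
  qed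
  show ?P if "j < n"
  proof -
    have "W ! (base I + 4 * n + 6 + 3 * j) = v ! (3 * j + 2)"
      using y' u by (simp add: W nth_append)
    then show ?thesis
      using v that P[OF that] y'w[OF wire_less(2)[OF that]] y'x[OF that] y' wire_less(2)[OF that] nb
      by (auto simp: nth_append)
  qed
  show "W ! (base I + n + 3) = (b ! 0 \<and> True \<in> set (tl b))"
    using y' by (simp add: W nth_append h_def)
  show ?V if "j < n"
    using that y' wire_less(3)[of "Suc j"] y'w V[of "Suc j"] by (simp add: W nth_append)
qed

end

section \<open>Correctness of the reduction\<close>

lemma horner_sum_bits_nonneg: "horner_sum of_bool 2 bs \<ge> (0 :: int)"
  by (induction bs) auto

lemma horner_sum_bits_pos_iff: "horner_sum of_bool 2 bs > (0 :: int) \<longleftrightarrow> True \<in> set bs"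
proof (induction bs)
  case (Cons b bs)
  with horner_sum_bits_nonneg[of bs] show ?case by auto
qed simp

lemma circuit_eval_new_circuit:
  "circuit_eval (new_circuit I os) x = map ((!) (run (new_gates I) x)) os"
  by (simp add: circuit_eval_def circuit_wires_def new_circuit_def)

context
  fixes I
  assumes met: "metered_line_instance I"
begin

lemma succ_potential_of:
  assumes "length x = dim I"
  shows "succ_of (potential_of I) x = (if value_of I x > 0 then succ_of I x else x)"
  using run_new_gates(1)[OF met refl assms] outputs_S(1)[OF met refl] assms
  by (auto simp: potential_of_def circuit_eval_new_circuit outs_S_def circuit_number_def
      horner_sum_bits_pos_iff circuit_eval_def[of "succ_circuit I"] intro!: nth_equalityI)

lemma pred_potential_of:
  assumes "length x = dim I"
  shows "pred_of (potential_of I) x = (if value_of I x > 0 then pred_of I x else x)"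
  using run_new_gates(2)[OF met refl assms] outputs_P(1)[OF met refl] assms
  by (auto simp: potential_of_def circuit_eval_new_circuit outs_P_def circuit_number_def
      horner_sum_bits_pos_iff circuit_eval_def[of "pred_circuit I"] intro!: nth_equalityI)

text \<open>The low bit survives only next to a set higher bit, and 1 is the one number that has it
  alone.\<close>

lemma value_potential_of:
  assumes "length x = dim I"
  shows "value_of (potential_of I) x = (if value_of I x = 1 then 0 else value_of I x)"
proof -
  define b where "b = circuit_eval (value_circuit I) x"
  have len: "length b = Suc (dim I)"
    using outputs_V(1)[OF met refl] by (simp add: b_def circuit_eval_def)
  then obtain c cs where b: "b = c # cs" "length cs = dim I" by (cases b) auto
  note run = run_new_gates(3,4)[OF met refl assms, folded b_def]
  have "map ((!) (run (new_gates I) x)) (map (\<lambda>j. wire_V I (Suc j)) [0..<dim I]) = cs"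
    using run(2) b by (auto intro!: nth_equalityI)
  then have "circuit_eval (new_circuit I (outs_V I)) x = (c \<and> True \<in> set cs) # cs"
    using run(1) b(1) by (simp add: circuit_eval_new_circuit outs_V_def)
  then have new: "value_of (potential_of I) x = of_bool (c \<and> True \<in> set cs) + 2 * horner_sum of_bool 2 cs"
    by (simp add: potential_of_def circuit_number_def)
  have old: "value_of I x = of_bool c + 2 * horner_sum of_bool 2 cs"
    using b by (simp add: circuit_number_def b_def[symmetric])
  show ?thesis
    using horner_sum_bits_pos_iff[of cs] horner_sum_bits_nonneg[of cs] unfolding new old
    by (cases c; cases "True \<in> set cs") auto
qed

lemma length_succ_of: "length (succ_of I x) = dim I"
  using outputs_S(1)[OF met refl] by (simp add: circuit_eval_def)

lemma length_pred_of: "length (pred_of I x) = dim I"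
  using outputs_P(1)[OF met refl] by (simp add: circuit_eval_def)

lemma value_of_nonneg: "value_of I x \<ge> 0"
  by (simp add: circuit_number_def horner_sum_bits_nonneg)

text \<open>The start vertex has meter 1 > 0, so S and P are unchanged there, while its value drops
  to 0.\<close>

lemma potential_line_instance_potential_of: "potential_line_instance (potential_of I)"
proof -
  let ?n = "dim I"
  have dim: "dim (potential_of I) = ?n" by (simp add: potential_of_def)
  have circ: "is_circuit (new_circuit I os) ?n (length os)"
    if "\<forall>i \<in> set os. i < base I + 7 * ?n + 4" for os
    using wf_new_gates[OF met refl] that length_new_gates[of I]
    by (auto simp: is_circuit_def new_circuit_def wf_gates_def gate_count_def base_def)
  have V: "wire_V I (Suc j) < base I + 7 * ?n + 4" if "j < ?n" for j
    using wire_less(3)[OF met refl, of "Suc j"] that by simp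
  have "is_circuit (new_circuit I (outs_S I)) ?n ?n" "is_circuit (new_circuit I (outs_P I)) ?n ?n"
    "is_circuit (new_circuit I (outs_V I)) ?n (Suc ?n)"
    using circ[of "outs_S I"] circ[of "outs_P I"] circ[of "outs_V I"] V
    by (auto simp: outs_S_def outs_P_def outs_V_def)
  then show ?thesis
    using met succ_potential_of[of "zeros ?n"] pred_potential_of[of "zeros ?n"]
      value_potential_of[of "zeros ?n"]
    unfolding potential_line_instance_def metered_line_instance_def dim
    by (auto simp: potential_of_def)
qed

lemma metered_line_solution_if_potential:
  assumes "potential_line_solution (potential_of I) x"
  shows "metered_line_solution I x"
proof -
  let ?V = "value_of I" and ?S = "succ_of I" and ?P = "pred_of I" and ?z = "zeros (dim I)"
  have dim: "dim (potential_of I) = dim I" by (simp add: potential_of_def)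
  have len: "length x = dim I" using assms by (simp add: potential_line_solution_def dim)
  note new = succ_potential_of pred_potential_of value_potential_of
  note eqs = new[OF len] new[OF length_succ_of] new[OF length_pred_of]
  \<comment> \<open>A vertex of meter 0 is fixed by both new maps, which excludes R1 as well as
    R2.\<close>
  have pos: "?V x > 0"
    using assms len value_of_nonneg[of x]
    by (cases "?V x = 0") (auto simp: potential_line_solution_def eqs dim)
  show ?thesis
  proof (rule ccontr)
    assume neg: "\<not> metered_line_solution I x"
    have S: "?V (?S x) = ?V x + 1" "?P (?S x) = x"
      and P: "?V x > 1 \<Longrightarrow> ?V (?P x) = ?V x - 1" "x \<noteq> ?z \<Longrightarrow> ?S (?P x) = x"
      and 1: "?V x = 1 \<Longrightarrow> x = ?z"
      using neg pos len by (auto simp: metered_line_solution_def)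
    \<comment> \<open>Away from the origin the meter is not 1, as x is not of type T2; so it exceeds
      1 and drops by exactly 1 at the predecessor.\<close>
    have "?V (?P x) > 0" if "x \<noteq> ?z" using P(1) 1 that pos by force
    \<comment> \<open>The meter of S(x) is at least 2 and hence not lowered, and lowering the value
      at x can only increase the gain.\<close>
    then show False
      using assms S P(2) pos
      by (auto simp: potential_line_solution_def eqs dim split: if_splits)
  qed
qed

end

section \<open>Layout of the encoded input\<close>

lemma mem_middle: "length xs = a \<Longrightarrow> j < length os \<Longrightarrow> mem (xs @ os @ ys) (a + j) = os ! j"
  by (auto simp: mem_def nth_append)

lemma mem_enc_gates:
  assumes "length xs = a" "j < length gs"
  shows "[mem (xs @ enc_gates gs @ ys) (a + 3 * j), mem (xs @ enc_gates gs @ ys) (a + 3 * j + 1),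
     mem (xs @ enc_gates gs @ ys) (a + 3 * j + 2)] = enc_gate (gs ! j)"
proof -
  let ?as = "xs @ enc_gates (take j gs)" and ?bs = "enc_gates (drop (Suc j) gs) @ ys"
  have "map enc_gate gs = map enc_gate (take j gs) @ enc_gate (gs ! j) # map enc_gate (drop (Suc j) gs)"
    using arg_cong[OF id_take_nth_drop[OF assms(2)], of "map enc_gate"] by simp
  then have l: "xs @ enc_gates gs @ ys = ?as @ enc_gate (gs ! j) @ ?bs" by simp
  have len: "length ?as = a + 3 * j"
    using assms by (simp only: length_append length_enc_gates length_take)
  have *: "mem (xs @ enc_gates gs @ ys) (a + 3 * j + c) = enc_gate (gs ! j) ! c" if "c < 3" for c
    using mem_middle[OF len, of c "enc_gate (gs ! j)" ?bs] that unfolding l by simp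
  have "length (enc_gate (gs ! j)) = 3" by simp
  then show ?thesis using *[of 0] *[of 1] *[of 2]
    by (cases "gs ! j") simp_all
qed


context
  fixes I
  assumes met: "metered_line_instance I"
begin

lemma num_inputs: "num_inputs (succ_circuit I) = dim I" "num_inputs (pred_circuit I) = dim I"
    "num_inputs (value_circuit I) = dim I"
  using met by (auto simp: metered_line_instance_def is_circuit_def)

lemmas output_lengths = outputs_S(1)[OF met refl] outputs_P(1)[OF met refl] outputs_V(1)[OF met refl]

text \<open>In dimension 0 the origin is the only vertex, so S could not move it.\<close>

lemma dim_pos: "dim I > 0"
proof (rule ccontr)
  assume "\<not> dim I > 0"
  then show False
    using met length_succ_of[OF met, of "[]"] by (simp add: metered_line_instance_def)
qed

lemma length_enc_instance: "length (enc_instance I) = pos_eV I + dim I + 1"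
  by (simp add: enc_instance_def enc_circuit_def output_lengths pos_eV_def pos_aV_def pos_eP_def
      pos_aP_def pos_eS_def del: map_concat map_map)

text \<open>The words in front of the gates of each circuit; their lengths are the start addresses
  of the gates.\<close>

abbreviation (input) head_S :: "nat list" where
  "head_S \<equiv> [dim I, dim I, length (gates (succ_circuit I)), dim I]"
abbreviation (input) head_P :: "nat list" where
  "head_P \<equiv> head_S @ enc_gates (gates (succ_circuit I)) @ outputs (succ_circuit I) @
     [dim I, length (gates (pred_circuit I)), dim I]"
abbreviation (input) head_V :: "nat list" where
  "head_V \<equiv> head_P @ enc_gates (gates (pred_circuit I)) @ outputs (pred_circuit I) @
     [dim I, length (gates (value_circuit I)), dim I + 1]"

lemma enc_instance_eq:
  "enc_instance I = head_V @ enc_gates (gates (value_circuit I)) @ outputs (value_circuit I)"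
  by (simp add: enc_instance_def enc_circuit_def output_lengths num_inputs)

lemma length_heads: "length head_S = 4" "length head_P = pos_aP I" "length head_V = pos_aV I"
  by (simp_all add: output_lengths pos_aV_def pos_eP_def pos_aP_def pos_eS_def)

lemma input_gates:
  "j < length (gates (succ_circuit I)) \<Longrightarrow>
    [mem (enc_instance I @ r) (4 + 3 * j), mem (enc_instance I @ r) (4 + 3 * j + 1),
     mem (enc_instance I @ r) (4 + 3 * j + 2)] = enc_gate (gates (succ_circuit I) ! j)"
  "j < length (gates (pred_circuit I)) \<Longrightarrow>
    [mem (enc_instance I @ r) (pos_aP I + 3 * j), mem (enc_instance I @ r) (pos_aP I + 3 * j + 1),
     mem (enc_instance I @ r) (pos_aP I + 3 * j + 2)] = enc_gate (gates (pred_circuit I) ! j)"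
  "j < length (gates (value_circuit I)) \<Longrightarrow>
    [mem (enc_instance I @ r) (pos_aV I + 3 * j), mem (enc_instance I @ r) (pos_aV I + 3 * j + 1),
     mem (enc_instance I @ r) (pos_aV I + 3 * j + 2)] = enc_gate (gates (value_circuit I) ! j)"
  subgoal
    using mem_enc_gates[OF length_heads(1), of j "gates (succ_circuit I)"]
    unfolding enc_instance_eq append.assoc by blast
  subgoal
    using mem_enc_gates[OF length_heads(2), of j "gates (pred_circuit I)"]
    unfolding enc_instance_eq append.assoc by blast
  subgoal
    using mem_enc_gates[OF length_heads(3), of j "gates (value_circuit I)"]
    unfolding enc_instance_eq append.assoc by blast
  done

lemma input_outputs:
  "j < dim I \<Longrightarrow> mem (enc_instance I @ r) (pos_eS I + j) = outputs (succ_circuit I) ! j"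
  "j < dim I \<Longrightarrow> mem (enc_instance I @ r) (pos_eP I + j) = outputs (pred_circuit I) ! j"
  "j < dim I + 1 \<Longrightarrow> mem (enc_instance I @ r) (pos_eV I + j) = outputs (value_circuit I) ! j"
proof -
  have len: "length (head_S @ enc_gates (gates (succ_circuit I))) = pos_eS I"
    "length (head_P @ enc_gates (gates (pred_circuit I))) = pos_eP I"
    "length (head_V @ enc_gates (gates (value_circuit I))) = pos_eV I"
    unfolding length_append length_heads length_enc_gates
    by (simp_all add: output_lengths pos_aV_def pos_eP_def pos_aP_def pos_eS_def pos_eV_def)
  show "j < dim I \<Longrightarrow> mem (enc_instance I @ r) (pos_eS I + j) = outputs (succ_circuit I) ! j"
    using mem_middle[OF len(1), of j "outputs (succ_circuit I)"]
    unfolding output_lengths enc_instance_eq append.assoc by blast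
  show "j < dim I \<Longrightarrow> mem (enc_instance I @ r) (pos_eP I + j) = outputs (pred_circuit I) ! j"
    using mem_middle[OF len(2), of j "outputs (pred_circuit I)"]
    unfolding output_lengths enc_instance_eq append.assoc by blast
  show "j < dim I + 1 \<Longrightarrow> mem (enc_instance I @ r) (pos_eV I + j) = outputs (value_circuit I) ! j"
    using mem_middle[OF len(3), of j "outputs (value_circuit I)"]
    unfolding output_lengths enc_instance_eq append.assoc Suc_eq_plus1 by blast
qed

lemma input_header:
  "mem (enc_instance I @ r) 0 = dim I"
  "mem (enc_instance I @ r) 2 = length (gates (succ_circuit I))"
  "mem (enc_instance I @ r) (pos_eS I + dim I + 1) = length (gates (pred_circuit I))"
  "mem (enc_instance I @ r) (pos_eP I + dim I + 1) = length (gates (value_circuit I))"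
proof -
  show "mem (enc_instance I @ r) 0 = dim I"
    "mem (enc_instance I @ r) 2 = length (gates (succ_circuit I))"
    by (simp_all add: enc_instance_eq mem_def)
  let ?S = "head_S @ enc_gates (gates (succ_circuit I)) @ outputs (succ_circuit I)"
  let ?P = "head_P @ enc_gates (gates (pred_circuit I)) @ outputs (pred_circuit I)"
  have len: "length ?S = pos_eS I + dim I" "length ?P = pos_eP I + dim I"
    unfolding length_append length_heads length_enc_gates
    by (simp_all add: output_lengths pos_aV_def pos_eP_def pos_aP_def pos_eS_def pos_eV_def)
  \<comment> \<open>Index 1 picks the gate count out of the three header words.\<close>
  show "mem (enc_instance I @ r) (pos_eS I + dim I + 1) = length (gates (pred_circuit I))"
    using mem_middle[OF len(1), of 1 "[dim I, length (gates (pred_circuit I)), dim I]"]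
    unfolding enc_instance_eq append.assoc by simp
  show "mem (enc_instance I @ r) (pos_eP I + dim I + 1) = length (gates (value_circuit I))"
    using mem_middle[OF len(2), of 1 "[dim I, length (gates (value_circuit I)), dim I + 1]"]
    unfolding enc_instance_eq append.assoc by simp
qed

end

section \<open>Generating the gate list\<close>

text \<open>Exact step counts are hidden here: only a state predicate is passed on while the time
  bounds add up, so long programs are composed without being unfolded.\<close>

lemma wp_block_Cons:
  assumes "wp B c (\<lambda>t s. t \<le> T1 \<and> P s) s"
    and "\<And>R M. P (R, M) \<Longrightarrow> wp B (block cs) (\<lambda>t s. t \<le> T2 \<and> Q s) (R, M)"
  shows "wp B (block (c # cs)) (\<lambda>t s. t \<le> T1 + T2 \<and> Q s) s"
proof -
  have "wp B (block cs) (\<lambda>u s. t + u \<le> T1 + T2 \<and> Q s) s'" if "t \<le> T1 \<and> P s'" for t s'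
    using that assms(2)[of "fst s'" "snd s'"] by (auto elim!: wp_mono)
  then show ?thesis using assms(1) by (auto elim!: wp_mono)
qed

text \<open>The closing empty block overwrites \<open>r_junk\<close>, hence the stability condition
  and the extra step.\<close>

lemma wp_block_single:
  assumes "wp B c (\<lambda>t s. t \<le> T \<and> P s) s"
    and "\<And>R M. P (R, M) \<Longrightarrow> P (R(r_junk := 0), M)"
  shows "wp B (block [c]) (\<lambda>t s. t \<le> T + 1 \<and> P s) s"
  by (rule wp_block_Cons[OF assms(1)]) (simp add: assms(2))

lemma emitted_env: "emitted I l (R, M) \<Longrightarrow> env I R"
  by (simp add: emitted_Pair)

lemma emitted_junk [simp]: "emitted I l (R(r_junk := v), M) = emitted I l (R, M)"
  by (simp add: emitted_Pair)

definition run_gates :: "nat \<Rightarrow> nat \<Rightarrow> nat \<Rightarrow> ram" where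
  "run_gates a e d = block [Add r_src a r_zero, Add r_lim e r_zero, Add r_off d r_zero, gate_loop]"

text \<open>S is copied with shift 0, so that one routine serves all three circuits.\<close>

definition emit_core :: ram where
  "emit_core = block [run_gates r_aS r_eS r_zero, run_gates r_aP r_eP r_offP,
     run_gates r_aV r_eV r_offV]"

text \<open>Three zero words encode \<open>Const_Gate False\<close>. The disjunction starts one cell
  behind \<open>r_eV\<close> to skip the low bit, and ends at the input length because the outputs
  of V close the input. \<open>r_wire\<close> is left at the first multiplexer wire.\<close>

definition emit_tests :: ram where
  "emit_tests = block
     [emit [r_zero, r_zero, r_zero],
      block [Add r_src r_eV r_one, Add r_lim r_len r_zero, Add r_off r_offV r_zero,
        Add r_wire r_base r_zero, or_loop],
      Load r_x r_eV, Add r_off r_offV r_zero, shift_reg r_x,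
      Add r_pos r_wire r_one, Add r_neg r_pos r_one,
      emit [r_three, r_wire, r_x, r_one, r_pos, r_zero, r_two, r_wire, r_x],
      Add r_wire r_neg r_two]"

text \<open>\<open>r_wire\<close> enters as the first free wire and leaves behind the new gates, so
  a second call continues where the first one ended.\<close>

definition emit_select :: "nat \<Rightarrow> nat \<Rightarrow> ram" where
  "emit_select e d = block [Add r_src e r_zero, Add r_off d r_zero, Add r_idx r_zero r_zero, mux_loop]"

definition emit_gates :: ram where
  "emit_gates = block [emit_core, emit_tests, emit_select r_eS r_zero, emit_select r_eP r_offP]"

context
  fixes I and B :: nat
  assumes met: "metered_line_instance I"
begin

text \<open>Argument registers up to 16 cannot be overwritten by the set-up of the loop before they
  are read.\<close>

lemma wp_run_gates:
  assumes "emitted I l (R, M)" "R a' = a" "R e' = a + 3 * length gs" "R d' = d" "a' \<le> 16" "e' \<le> 16" "d' \<le> 16"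
    and input: "\<And>j. j < length gs \<Longrightarrow>
      [mem l (a + 3 * j), mem l (a + 3 * j + 1), mem l (a + 3 * j + 2)] = enc_gate (gs ! j)"
    and len: "a + 3 * length gs \<le> length l"
    and B: "length l + 3 * length gs < B" "3 \<le> B" "d \<le> B"
    and args: "wf_gates (dim I) gs" "dim I + d + length gs \<le> B"
  shows "wp B (run_gates a' e' d')
    (\<lambda>t s. t \<le> 30 * length gs + 5 \<and> emitted I (l @ enc_gates (map (shift_gate (dim I) d) gs)) s) (R, M)"
proof -
  let ?R = "R(r_src := a, r_lim := a + 3 * length gs, r_off := d)"
  have args': "i + d < B" if "j < length gs" "i \<in> gate_args (gs ! j)" for i j
    using args that by (fastforce simp: wf_gates_def)
  have "emitted I l (?R, M)" using assms(1) by (simp add: emitted_Pair)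
  then have loop: "wp B gate_loop
    (\<lambda>t s. t \<le> 30 * length gs + 1 \<and> emitted I (l @ enc_gates (map (shift_gate (dim I) d) gs)) s) (?R, M)"
    by (rule wp_gate_loop[OF _ _ _ _ input len B(1,2) args' dim_pos[OF met]]) simp_all
  have "R r_zero = 0" using assms(1) by (auto simp: emitted_Pair dest: envD)
  then have "wp B (run_gates a' e' d') Q (R, M) \<longleftrightarrow>
      wp B gate_loop (\<lambda>t. wp B (block []) (\<lambda>u. Q (Suc (Suc (Suc (t + u)))))) (?R, M)" for Q
    unfolding run_gates_def using assms(2-7) len B by simp
  then show ?thesis
    by (simp del: block.simps map_map) (rule wp_mono[OF loop], auto simp del: map_map)
qed

lemma wp_emit_core:
  assumes em: "emitted I (enc_instance I @ r) (R, M)" and B: "length (enc_instance I @ r) + 3 * gate_count I < B"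
  shows "wp B emit_core (\<lambda>t s. t \<le> 30 * gate_count I + 16 \<and>
    emitted I (enc_instance I @ r @ enc_gates (core_gates I)) s) (R, M)"
proof -
  note defs = pos_eS_def pos_aP_def pos_eP_def pos_aV_def pos_eV_def off_P_def off_V_def base_def gate_count_def
  note len = length_enc_instance[OF met]
  note in_gates = input_gates[OF met]
  let ?gS = "enc_gates (map (shift_gate (dim I) 0) (gates (succ_circuit I)))"
  let ?gP = "enc_gates (map (shift_gate (dim I) (off_P I)) (gates (pred_circuit I)))"
  let ?gV = "enc_gates (map (shift_gate (dim I) (off_V I)) (gates (value_circuit I)))"
  have lens: "length ?gS = 3 * length (gates (succ_circuit I))" 
    "length ?gP = 3 * length (gates (pred_circuit I))"
    by (simp_all only: length_enc_gates length_map)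
  have stepS: "wp B (run_gates r_aS r_eS r_zero)
     (\<lambda>t s. t \<le> 30 * length (gates (succ_circuit I)) + 5 \<and> emitted I (enc_instance I @ r @ ?gS) s) (R, M)"
    if "emitted I (enc_instance I @ r) (R, M)" for R M
    using wp_run_gates[OF that _ _ _ _ _ _ in_gates(1) _ _ _ _ wf_S[OF met refl], where a' = r_aS and e' = r_eS and d' = r_zero and d = 0]
      B len by (simp add: envD[OF emitted_env[OF that]] defs del: map_map)
  have stepP: "wp B (run_gates r_aP r_eP r_offP)
     (\<lambda>t s. t \<le> 30 * length (gates (pred_circuit I)) + 5 \<and> emitted I (enc_instance I @ r @ ?gS @ ?gP) s) (R, M)"
    if "emitted I (enc_instance I @ r @ ?gS) (R, M)" for R M
    using wp_run_gates[OF that _ _ _ _ _ _ in_gates(2) _ _ _ _ wf_P[OF met refl], where a' = r_aP and e' = r_eP and d' = r_offP and d = "off_P I"]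
      B len lens by (simp add: envD[OF emitted_env[OF that]] defs del: map_map)
  have stepV: "wp B (run_gates r_aV r_eV r_offV)
     (\<lambda>t s. t \<le> 30 * length (gates (value_circuit I)) + 5 \<and> emitted I (enc_instance I @ r @ ?gS @ ?gP @ ?gV) s) (R, M)"
    if "emitted I (enc_instance I @ r @ ?gS @ ?gP) (R, M)" for R M
    using wp_run_gates[OF that _ _ _ _ _ _ in_gates(3) _ _ _ _ wf_V[OF met refl], where a' = r_aV and e' = r_eV and d' = r_offV and d = "off_V I"]
      B len lens by (simp add: envD[OF emitted_env[OF that]] defs del: map_map)
  have "wp B emit_core (\<lambda>t s. t \<le> 30 * gate_count I + 16 \<and>
      emitted I (enc_instance I @ r @ ?gS @ ?gP @ ?gV) s) (R, M)"
    unfolding emit_core_def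
    by (rule wp_mono[OF wp_block_Cons[OF stepS[OF em] wp_block_Cons[OF stepP wp_block_single[OF stepV]]]])
      (auto simp: defs simp del: map_map)
  then show ?thesis by (simp add: core_gates_def)
qed

lemma wp_emit_tests:
  assumes em: "emitted I (enc_instance I @ r) (R, M)" and B: "length (enc_instance I @ r) + 3 * dim I + 12 < B" "base I + dim I + 4 \<le> B"
  shows "wp B emit_tests (\<lambda>t s. t \<le> 20 * dim I + 60 \<and>
    (emitted I (enc_instance I @ r @ enc_gates (test_gates I)) s \<and> fst s r_pos = base I + dim I + 1 \<and>
     fst s r_neg = base I + dim I + 2 \<and> fst s r_wire = base I + dim I + 4)) (R, M)"
proof -
  note defs = gate_count_def base_def
  note len = length_enc_instance[OF met]
  let ?or = "enc_gates (or_gates (base I) (\<lambda>j. wire_V I (Suc j)) (dim I))"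
  have len_or: "length ?or = 3 * dim I" by (simp only: length_enc_gates length_or_gates)
  have outV: "outputs (value_circuit I) ! j + off_V I < B" if "j < Suc (dim I)" for j
    using outputs_V(2)[OF met refl that] B len by (simp add: defs)
  have step2: "wp B (block [Add r_src r_eV r_one, Add r_lim r_len r_zero, Add r_off r_offV r_zero,
        Add r_wire r_base r_zero, or_loop])
      (\<lambda>t s. t \<le> 20 * dim I + 6 \<and>
        (emitted I (enc_instance I @ r @ [0, 0, 0] @ ?or) s \<and> fst s r_wire = base I + dim I)) (R, M)"
    if em: "emitted I (enc_instance I @ r @ [0, 0, 0]) (R, M)" for R M
  proof -
    note R = envD[OF emitted_env[OF em]]
    let ?R = "R(r_src := Suc (pos_eV I), r_lim := Suc (pos_eV I + dim I), r_off := off_V I, r_wire := base I)"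
    have "emitted I (enc_instance I @ r @ [0, 0, 0]) (?R, M)" using em by (simp add: emitted_Pair)
    then have loop: "wp B or_loop (\<lambda>t s. t \<le> 20 * dim I + 1 \<and>
        emitted I ((enc_instance I @ r @ [0, 0, 0]) @ enc_gates (or_gates (base I)
          (\<lambda>j. shift_wire (dim I) (off_V I) (outputs (value_circuit I) ! Suc j)) (dim I))) s \<and>
        fst s r_wire = base I + dim I) (?R, M)"
    proof (rule wp_or_loop[where a = "Suc (pos_eV I)" and d = "off_V I"])
      show "mem (enc_instance I @ r @ [0, 0, 0]) (Suc (pos_eV I) + j) = outputs (value_circuit I) ! Suc j"
        if "j < dim I" for j
        using input_outputs(3)[OF met, of "Suc j" "r @ [0, 0, 0]"] that by simp
    qed (use B len outV in \<open>simp_all add: defs\<close>)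
    have "wp B (block [Add r_src r_eV r_one, Add r_lim r_len r_zero, Add r_off r_offV r_zero,
        Add r_wire r_base r_zero, or_loop]) Q (R, M) \<longleftrightarrow>
      wp B or_loop (\<lambda>t. wp B (block []) (\<lambda>u. Q (Suc (Suc (Suc (Suc (t + u))))))) (?R, M)" for Q
      using R B len by (simp add: defs)
    then show ?thesis
      by (simp del: block.simps map_map) (rule wp_mono[OF loop], auto simp: wire_V_def)
  qed
  have step1: "wp B (emit [r_zero, r_zero, r_zero])
      (\<lambda>t s. t \<le> 7 \<and> emitted I (enc_instance I @ r @ [0, 0, 0]) s) (R, M)"
    using em B by (simp add: emitted_Pair envD[OF emitted_env[OF em]] defs)
  have step3: "wp B (block [Load r_x r_eV, Add r_off r_offV r_zero, shift_reg r_x,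
      Add r_pos r_wire r_one, Add r_neg r_pos r_one,
      emit [r_three, r_wire, r_x, r_one, r_pos, r_zero, r_two, r_wire, r_x],
      Add r_wire r_neg r_two])
      (\<lambda>t s. t \<le> 40 \<and> (emitted I (enc_instance I @ r @ enc_gates (test_gates I)) s \<and>
        fst s r_pos = base I + dim I + 1 \<and> fst s r_neg = base I + dim I + 2 \<and>
        fst s r_wire = base I + dim I + 4)) (R, M)"
    if *: "emitted I (enc_instance I @ r @ [0, 0, 0] @ ?or) (R, M) \<and> fst (R, M) r_wire = base I + dim I" for R M
  proof -
    define l where "l = enc_instance I @ r @ [0, 0, 0] @ ?or"
    have M: "M = mem l" "R r_out = length l" and R: "env I R" "R r_wire = base I + dim I"
      using * by (simp_all add: emitted_Pair l_def)
    have V0: "mem l (pos_eV I) = outputs (value_circuit I) ! 0"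
      using input_outputs(3)[OF met, of 0 "r @ [0, 0, 0] @ ?or"] by (simp add: l_def)
    have bounds: "length l + 9 \<le> B" "base I + dim I + 4 \<le> B" "pos_eV I \<le> B"
      using B len len_or by (simp_all add: l_def defs)
    have wV: "shift_wire (dim I) (off_V I) (outputs (value_circuit I) ! 0) = wire_V I 0"
      by (simp add: wire_V_def)
    have "wire_V I 0 \<le> B"
      using shift_wire_le[of "dim I" "off_V I" "outputs (value_circuit I) ! 0"] outV[of 0]
      unfolding wV by simp
    moreover have "enc_instance I @ r @ enc_gates (test_gates I) =
        l @ [3, base I + dim I, wire_V I 0, 1, base I + dim I + 1, 0, 2, base I + dim I, wire_V I 0]"
      by (simp add: test_gates_def l_def)
    ultimately show ?thesis
      using R M(2) outV[of 0] bounds unfolding M(1)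
      by (simp add: emitted_Pair envD[OF R(1)] V0 wV)
  qed
  show ?thesis
    unfolding emit_tests_def
    by (rule wp_mono[OF wp_block_Cons[OF step1 wp_block_Cons[OF step2 step3]]]) simp_all
qed

lemma wp_emit_select:
  assumes em: "emitted I (enc_instance I @ r) (R, M)" and e: "R e' = e" "R d' = d" "e' \<le> 16" "d' \<le> 16"
    and z: "R r_pos = base I + dim I + 1" "R r_neg = base I + dim I + 2" "R r_wire = w"
    and input: "\<And>j. j < dim I \<Longrightarrow> mem (enc_instance I @ r) (e + j) = os ! j"
    and B: "length (enc_instance I @ r) + 9 * dim I < B" "base I + dim I + 4 \<le> B" "w + 3 * dim I < B" "e + dim I \<le> length (enc_instance I)"
    and args: "\<And>j. j < dim I \<Longrightarrow> os ! j + d < B" "d \<le> B"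
    and p: "\<And>j. p j = shift_wire (dim I) d (os ! j)"
  shows "wp B (emit_select e' d') (\<lambda>t s. t \<le> 40 * dim I + 5 \<and>
    (emitted I (enc_instance I @ r @ enc_gates (select_gates I w p)) s \<and> fst s r_pos = base I + dim I + 1 \<and>
     fst s r_neg = base I + dim I + 2 \<and> fst s r_wire = w + 3 * dim I)) (R, M)"
proof -
  note R = envD[OF emitted_env[OF em]]
  let ?R = "R(r_src := e, r_off := d, r_idx := 0)"
  have "emitted I (enc_instance I @ r) (?R, M)" using em by (simp add: emitted_Pair)
  then have loop: "wp B mux_loop (\<lambda>t s. t \<le> 40 * dim I + 1 \<and>
      emitted I ((enc_instance I @ r) @ enc_gates (mux_gates (base I + dim I + 1) (base I + dim I + 2) w
        (\<lambda>j. shift_wire (dim I) d (os ! j)) (dim I))) s \<and>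
      fst s r_wire = w + 3 * dim I \<and> fst s r_pos = base I + dim I + 1 \<and>
      fst s r_neg = base I + dim I + 2) (?R, M)"
    by (rule wp_mux_loop[OF _ _ _ _ _ _ _ input]) (use z B args in simp_all)
  have "wp B (emit_select e' d') Q (R, M) \<longleftrightarrow>
      wp B mux_loop (\<lambda>t. wp B (block []) (\<lambda>u. Q (Suc (Suc (Suc (t + u)))))) (?R, M)" for Q
    unfolding emit_select_def using e R B args(2) by simp
  then show ?thesis
    by (simp del: block.simps map_map) (rule wp_mono[OF loop], auto simp: p[abs_def] select_gates_def)
qed

lemma wp_emit_gates:
  assumes em: "emitted I (enc_instance I @ r) (R, M)" and B: "length (enc_instance I @ r) + 3 * gate_count I < B"
  shows "wp B emit_gates (\<lambda>t s. t \<le> 50 * gate_count I + 150 \<and>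
    emitted I (enc_instance I @ r @ enc_gates (new_gates I)) s) (R, M)"
proof -
  note defs = gate_count_def base_def
  note pos = pos_eS_def pos_aP_def pos_eP_def pos_aV_def pos_eV_def
  note len = length_enc_instance[OF met]
  define r1 where "r1 = r @ enc_gates (core_gates I)"
  define r2 where "r2 = r1 @ enc_gates (test_gates I)"
  define r3 where "r3 = r2 @ enc_gates (select_gates I (base I + dim I + 4) (wire_S I))"
  define r4 where "r4 = r3 @ enc_gates (select_gates I (base I + 4 * dim I + 4) (wire_P I))"
  have lens: "length r1 + 3 * dim I = length r + 3 * base I" "length r2 = length r1 + 3 * dim I + 12"
    "length r3 = length r2 + 9 * dim I"
    using length_core_gates[of I] unfolding r1_def r2_def r3_def length_append length_enc_gates
    by (simp_all add: length_test_gates select_gates_def)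
  have B1: "length (enc_instance I @ r1) + 21 * dim I + 12 < B" "base I + 7 * dim I + 4 < B"
    using B lens len by (simp_all add: defs)
  have em1: "wp B emit_core (\<lambda>t s. t \<le> 30 * gate_count I + 16 \<and> emitted I (enc_instance I @ r1) s) (R, M)"
    using wp_emit_core[OF em B] by (simp add: r1_def)
  let ?P = "\<lambda>r w s. emitted I (enc_instance I @ r) s \<and> fst s r_pos = base I + dim I + 1 \<and>
     fst s r_neg = base I + dim I + 2 \<and> fst s r_wire = w"
  have em2: "wp B emit_tests (\<lambda>t s. t \<le> 20 * dim I + 60 \<and> ?P r2 (base I + dim I + 4) s) (R, M)"
    if "emitted I (enc_instance I @ r1) (R, M)" for R M
    using wp_emit_tests[OF that] B1 by (simp add: r2_def)
  have outs: "outputs (succ_circuit I) ! j < base I"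
    "outputs (pred_circuit I) ! j + off_P I < base I" if "j < dim I" for j
    using outputs_S(2)[OF met refl that] outputs_P(2)[OF met refl that]
    by (simp_all add: defs off_V_def off_P_def)
  have "wp B (emit_select r_eS r_zero) (\<lambda>t s. t \<le> 40 * dim I + 5 \<and>
      ?P r3 (base I + dim I + 4 + 3 * dim I) s) (R, M)"
    if P: "?P r2 (base I + dim I + 4) (R, M)" for R M
    unfolding r3_def
  proof (rule wp_emit_select[where e = "pos_eS I" and d = 0 and os = "outputs (succ_circuit I)"])
    show "mem (enc_instance I @ r2) (pos_eS I + j) = outputs (succ_circuit I) ! j" if "j < dim I" for j
      using input_outputs(1)[OF met that] .
    show "outputs (succ_circuit I) ! j + 0 < B" if "j < dim I" for j
      using outs(1)[OF that] B1(2) by simp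
  qed (use P B1 lens len envD[OF emitted_env[OF P[THEN conjunct1]]] in \<open>simp_all add: wire_S_def pos\<close>)
  then have em3: "wp B (emit_select r_eS r_zero) (\<lambda>t s. t \<le> 40 * dim I + 5 \<and>
      ?P r3 (base I + 4 * dim I + 4) s) (R, M)"
    if "?P r2 (base I + dim I + 4) (R, M)" for R M
    using that by (simp add: algebra_simps)
  have "wp B (emit_select r_eP r_offP) (\<lambda>t s. t \<le> 40 * dim I + 5 \<and>
      ?P r4 (base I + 4 * dim I + 4 + 3 * dim I) s) (R, M)"
    if P: "?P r3 (base I + 4 * dim I + 4) (R, M)" for R M
    unfolding r4_def
  proof (rule wp_emit_select[where e = "pos_eP I" and d = "off_P I" and os = "outputs (pred_circuit I)"])
    show "mem (enc_instance I @ r3) (pos_eP I + j) = outputs (pred_circuit I) ! j" if "j < dim I" for j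
      using input_outputs(2)[OF met that] .
    show "outputs (pred_circuit I) ! j + off_P I < B" if "j < dim I" for j
      using outs(2)[OF that] B1(2) by simp
    show "off_P I \<le> B" using B1(2) by (simp add: defs off_V_def)
  qed (use P B1 lens len envD[OF emitted_env[OF P[THEN conjunct1]]] in \<open>simp_all add: wire_P_def pos\<close>)
  then have em4: "wp B (emit_select r_eP r_offP) (\<lambda>t s. t \<le> 40 * dim I + 5 \<and>
      ?P r4 (base I + 7 * dim I + 4) s) (R, M)"
    if "?P r3 (base I + 4 * dim I + 4) (R, M)" for R M
    using that by (simp add: algebra_simps)
  \<comment> \<open>The disjunctions and the multiplexers cost at most \<open>100 * dim I\<close> in
    their loops, which \<open>20 * gate_count I\<close> covers since \<open>gate_count I\<close>
    exceeds \<open>7 * dim I\<close>.\<close>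
  have "wp B emit_gates (\<lambda>t s. t \<le> 50 * gate_count I + 150 \<and> ?P r4 (base I + 7 * dim I + 4) s) (R, M)"
    unfolding emit_gates_def
    by (rule wp_mono[OF wp_block_Cons[OF em1 wp_block_Cons[OF em2 wp_block_Cons[OF em3
          wp_block_single[OF em4]]]]])
      (auto simp: gate_count_def)
  then show ?thesis
    by (rule wp_mono) (simp add: r4_def r3_def r2_def r1_def new_gates_def)
qed

end

section \<open>The reduction and its running time\<close>

text \<open>\<open>c\<close> sets \<open>r_wire\<close> to the first output wire, the only
  difference between the successor and the predecessor circuit.\<close>

definition emit_wires :: "ram \<Rightarrow> ram" where
  "emit_wires c = block [emit [r_dim, r_gates, r_dim], emit_gates, c,
     block [Add r_idx r_zero r_zero, wires_loop]]"

definition start_S :: ram where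
  "start_S = block [Add r_wire r_base r_dim, Add r_wire r_wire r_three, Add r_wire r_wire r_three]"

definition start_P :: ram where
  "start_P = block [Add r_wire r_base r_dim, Add r_wire r_wire r_dim, Add r_wire r_wire r_dim,
       Add r_wire r_wire r_dim, Add r_wire r_wire r_three, Add r_wire r_wire r_three]"

definition emit_V :: ram where
  "emit_V = block [block [Add r_x r_dim r_one, emit [r_dim, r_gates, r_x]], emit_gates,
     block [Add r_wire r_base r_dim, Add r_wire r_wire r_three, emit [r_wire]],
     block [Add r_src r_eV r_one, Add r_lim r_len r_zero, Add r_off r_offV r_zero, copy_loop]]"

text \<open>\<open>r_offV\<close> and \<open>r_base\<close> first hold the gate counts of \<open>P\<close> and \<open>V\<close>.\<close>

definition read_layout :: ram where
  "read_layout = block [Load_Const r_one 1, Load_Const r_two 2, Load_Const r_three 3, Load_Const r_aS 4,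
     Load r_dim r_zero, Load r_offP r_two,
     Add r_eS r_aS r_offP, Add r_eS r_eS r_offP, Add r_eS r_eS r_offP,
     Add r_aP r_eS r_dim, Add r_aP r_aP r_one, Load r_offV r_aP, Add r_aP r_aP r_two,
     Add r_eP r_aP r_offV, Add r_eP r_eP r_offV, Add r_eP r_eP r_offV,
     Add r_offV r_offP r_offV,
     Add r_aV r_eP r_dim, Add r_aV r_aV r_one, Load r_base r_aV, Add r_aV r_aV r_two,
     Add r_eV r_aV r_base, Add r_eV r_eV r_base, Add r_eV r_eV r_base,
     Add r_gates r_offV r_base, Add r_base r_dim r_gates,
     Add r_gates r_gates r_dim, Add r_gates r_gates r_dim, Add r_gates r_gates r_dim,
     Add r_gates r_gates r_dim, Add r_gates r_gates r_dim, Add r_gates r_gates r_dim,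
     Add r_gates r_gates r_dim, Add r_gates r_gates r_aS,
     Add r_out r_len r_zero]"

text \<open>\<open>emit [r_dim]\<close> writes the dimension field. At the end the input length is
  saved as the output address before \<open>r_len\<close> receives the output length.\<close>

definition reduction_program :: ram where
  "reduction_program = block [read_layout, emit [r_dim], emit_wires start_S, emit_wires start_P, emit_V,
     block [Add 0 r_len r_zero, Sub r_len r_out r_len]]"

text \<open>The answer takes \<open>dim I + 1\<close> words, one of them for its length. Registers
  start at 0, so \<open>r_zero\<close> can be used at once.\<close>

definition solution_program :: ram where
  "solution_program = block [Load r_dim r_zero, Load_Const r_one 1, Add r_dim r_dim r_one,
     Sub 0 r_len r_dim, Add r_len r_dim r_zero]"

context
  fixes I and B :: nat
  assumes met: "metered_line_instance I"
begin

lemma enc_new_circuit: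
  "enc_circuit (new_circuit I os) =
     [dim I, gate_count I, length os] @ enc_gates (new_gates I) @ os"
  by (simp add: enc_circuit_def new_circuit_def length_new_gates)

lemma wp_emit_wires:
  assumes em: "emitted I (enc_instance I @ r) (R, M)" and B: "length (enc_instance I @ r) + 4 * gate_count I + 10 < B"
    and c: "\<And>l R M. emitted I l (R, M) \<Longrightarrow>
      wp B c (\<lambda>t s. t \<le> 10 \<and> (emitted I l s \<and> fst s r_wire = w)) (R, M)"
    and w: "w + 3 * dim I < B"
  shows "wp B (emit_wires c) (\<lambda>t s. t \<le> 70 * gate_count I + 200 \<and>
    emitted I (enc_instance I @ r @ enc_circuit (new_circuit I (map (\<lambda>j. w + 3 * j) [0..<dim I]))) s) (R, M)"
proof -
  note defs = gate_count_def base_def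
  note len = length_enc_instance[OF met]
  define r1 where "r1 = r @ [dim I, gate_count I, dim I]"
  define r2 where "r2 = r1 @ enc_gates (new_gates I)"
  have lens: "length r1 = length r + 3" "length r2 = length r1 + 3 * gate_count I"
    unfolding r1_def r2_def length_append length_enc_gates length_new_gates by simp_all
  let ?outs = "map (\<lambda>j. w + 3 * j) [0..<dim I]"
  have 1: "wp B (emit [r_dim, r_gates, r_dim]) (\<lambda>t s. t \<le> 7 \<and> emitted I (enc_instance I @ r1) s) (R, M)"
    using em B by (simp add: emitted_Pair envD[OF emitted_env[OF em]] defs r1_def)
  have 2: "wp B emit_gates (\<lambda>t s. t \<le> 50 * gate_count I + 150 \<and> emitted I (enc_instance I @ r2) s) (R, M)"
    if "emitted I (enc_instance I @ r1) (R, M)" for R M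
    using wp_emit_gates[OF met that] B lens by (simp add: r2_def)
  have 3: "wp B (block [Add r_idx r_zero r_zero, wires_loop])
      (\<lambda>t s. t \<le> 10 * dim I + 10 \<and> emitted I (enc_instance I @ r2 @ ?outs) s) (R, M)"
    if em: "emitted I (enc_instance I @ r2) (R, M) \<and> fst (R, M) r_wire = w" for R M
  proof -
    let ?R = "R(r_idx := 0)"
    have "emitted I (enc_instance I @ r2) (?R, M)" using em by (simp add: emitted_Pair)
    then have loop: "wp B wires_loop (\<lambda>t s. t \<le> 10 * dim I + 1 \<and>
        emitted I ((enc_instance I @ r2) @ ?outs) s) (?R, M)"
      by (rule wp_wires_loop) (use B len lens em w in \<open>simp_all add: defs\<close>)
    have "wp B (block [Add r_idx r_zero r_zero, wires_loop]) Q (R, M) \<longleftrightarrow>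
      wp B wires_loop (\<lambda>t. wp B (block []) (\<lambda>u. Q (Suc (t + u)))) (?R, M)" for Q
      using envD[OF emitted_env[OF em[THEN conjunct1]]] by simp
    then show ?thesis
      by (simp del: block.simps) (rule wp_mono[OF loop], auto)
  qed
  show ?thesis
    unfolding emit_wires_def
    by (rule wp_mono[OF wp_block_Cons[OF 1 wp_block_Cons[OF 2 wp_block_Cons[OF c wp_block_single[OF 3]]]]])
      (auto simp: gate_count_def enc_new_circuit r1_def r2_def)
qed

lemma wp_emit_V:
  assumes em: "emitted I (enc_instance I @ r) (R, M)" and B: "length (enc_instance I @ r) + 4 * gate_count I + 10 < B"
  shows "wp B emit_V (\<lambda>t s. t \<le> 70 * gate_count I + 200 \<and>
    emitted I (enc_instance I @ r @ enc_circuit (new_circuit I (outs_V I))) s) (R, M)"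
proof -
  note defs = gate_count_def base_def
  note len = length_enc_instance[OF met]
  define r1 where "r1 = r @ [dim I, gate_count I, dim I + 1]"
  define r2 where "r2 = r1 @ enc_gates (new_gates I)"
  have lens: "length r1 = length r + 3" "length r2 = length r1 + 3 * gate_count I"
    unfolding r1_def r2_def length_append length_enc_gates length_new_gates by simp_all
  have 1: "wp B (block [Add r_x r_dim r_one, emit [r_dim, r_gates, r_x]])
      (\<lambda>t s. t \<le> 9 \<and> emitted I (enc_instance I @ r1) s) (R, M)"
    using em B by (simp add: emitted_Pair envD[OF emitted_env[OF em]] defs r1_def)
  have 2: "wp B emit_gates (\<lambda>t s. t \<le> 50 * gate_count I + 150 \<and> emitted I (enc_instance I @ r2) s) (R, M)"
    if "emitted I (enc_instance I @ r1) (R, M)" for R M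
    using wp_emit_gates[OF met that] B lens by (simp add: r2_def)
  define r3 where "r3 = r2 @ [base I + dim I + 3]"
  have 3: "wp B (block [Add r_wire r_base r_dim, Add r_wire r_wire r_three, emit [r_wire]])
      (\<lambda>t s. t \<le> 6 \<and> emitted I (enc_instance I @ r3) s) (R, M)"
    if em: "emitted I (enc_instance I @ r2) (R, M)" for R M
    using em B len lens by (simp add: emitted_Pair envD[OF emitted_env[OF em]] r3_def defs)
  have 4: "wp B (block [Add r_src r_eV r_one, Add r_lim r_len r_zero, Add r_off r_offV r_zero, copy_loop])
      (\<lambda>t s. t \<le> 20 * dim I + 5 \<and> emitted I (enc_instance I @ r2 @ outs_V I) s) (R, M)"
    if em: "emitted I (enc_instance I @ r3) (R, M)" for R M
  proof -
    let ?R = "R(r_src := Suc (pos_eV I), r_lim := Suc (pos_eV I + dim I), r_off := off_V I)"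
    have "emitted I (enc_instance I @ r3) (?R, M)" using em by (simp add: emitted_Pair)
    then have loop: "wp B copy_loop (\<lambda>t s. t \<le> 20 * dim I + 1 \<and>
        emitted I ((enc_instance I @ r3) @ map (\<lambda>j. shift_wire (dim I) (off_V I)
          (outputs (value_circuit I) ! Suc j)) [0..<dim I]) s) (?R, M)"
    proof (rule wp_copy_loop[where a = "Suc (pos_eV I)"])
      show "mem (enc_instance I @ r3) (Suc (pos_eV I) + j) = outputs (value_circuit I) ! Suc j"
        if "j < dim I" for j
        using input_outputs(3)[OF met, of "Suc j" r3] that by simp
      show "outputs (value_circuit I) ! Suc j + off_V I < B" if "j < dim I" for j
        using outputs_V(2)[OF met refl, of "Suc j"] that B len by (simp add: defs)
    qed (use B len lens in \<open>simp_all add: defs r3_def\<close>)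
    have "wp B (block [Add r_src r_eV r_one, Add r_lim r_len r_zero, Add r_off r_offV r_zero, copy_loop])
        Q (R, M) \<longleftrightarrow>
      wp B copy_loop (\<lambda>t. wp B (block []) (\<lambda>u. Q (Suc (Suc (Suc (t + u)))))) (?R, M)" for Q
      using envD[OF emitted_env[OF em]] B len lens by (simp add: defs)
    then show ?thesis
      by (simp del: block.simps) (rule wp_mono[OF loop], auto simp: outs_V_def r3_def wire_V_def)
  qed
  show ?thesis
    unfolding emit_V_def
    by (rule wp_mono[OF wp_block_Cons[OF 1 wp_block_Cons[OF 2 wp_block_Cons[OF 3 wp_block_single[OF 4]]]]])
      (auto simp: gate_count_def enc_new_circuit r1_def r2_def outs_V_def)
qed

lemma wp_read_layout:
  assumes "R r_len = length (enc_instance I)" "R r_zero = 0" "M = mem (enc_instance I)" and B: "length (enc_instance I) + 4 * gate_count I + 10 < B"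
  shows "wp B read_layout (\<lambda>t s. t \<le> 40 \<and> emitted I (enc_instance I) s) (R, M)"
proof -
  note len = length_enc_instance[OF met]
  note pos = pos_eS_def pos_aP_def pos_eP_def pos_aV_def pos_eV_def off_P_def off_V_def base_def gate_count_def
  note hdr = input_header[OF met, of "[]", unfolded append_Nil2]
  define gS gP gV where g: "gS = length (gates (succ_circuit I))"
    "gP = length (gates (pred_circuit I))" "gV = length (gates (value_circuit I))"
  \<comment> \<open>The last two addresses are variables with an arithmetic premise, because
    symbolic execution yields these sums in other shapes.\<close>
  have hdr: "mem (enc_instance I) 0 = dim I" "mem (enc_instance I) 2 = gS"
     "a = 5 + 3 * gS + dim I \<Longrightarrow> mem (enc_instance I) a = gP"
     "a = 8 + 3 * gS + 3 * gP + 2 * dim I \<Longrightarrow> mem (enc_instance I) a = gV" for a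
    using hdr by (simp_all add: pos g algebra_simps)
  have B': "12 + 3 * gS + 3 * gP + 3 * gV + 3 * dim I + 4 * (gS + gP + gV + 7 * dim I + 4) < B"
    using B len by (simp add: pos g)
  show ?thesis
    using assms(1,2) B' len unfolding read_layout_def assms(3)
    apply (simp add: hdr emitted_Pair env_def pos g[symmetric])
    done
qed

end

section \<open>The two programs as a whole\<close>

lemma ram_input_eq: "ram_input xs = ((\<lambda>_. 0)(1 := length xs), mem xs)"
  by (auto simp: ram_input_def mem_def)

lemma ram_output_tail:
  assumes "fst s 0 = length xs" "fst s 1 = length ys" "snd s = mem (xs @ ys)"
  shows "ram_output s = ys"
  using assms by (cases s) (auto simp: ram_output_def mem_def intro!: nth_equalityI)

text \<open>A new circuit takes three words per gate and at most \<open>dim I + 1\<close> outputs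
  besides its header, so three of them fit into \<open>12 * gate_count I + 20\<close> words, and
  every address is below \<open>B\<close>.\<close>

lemma wp_reduction_program:
  assumes met: "metered_line_instance I"
    and B: "length (enc_instance I) + 12 * gate_count I + 20 < B"
  shows "wp B reduction_program (\<lambda>t s. t \<le> 210 * gate_count I + 700 \<and>
    ram_output s = enc_instance (potential_of I)) (ram_input (enc_instance I))"
proof -
  let ?inp = "enc_instance I"
  define r where "r os = enc_circuit (new_circuit I os)" for os
  have len_r: "length (r os) = 3 + 3 * gate_count I + length os" for os
    unfolding r_def enc_new_circuit[OF met] length_append length_enc_gates length_new_gates by simp
  have outs: "length (outs_S I) = dim I" "length (outs_P I) = dim I"
    by (simp_all add: outs_S_def outs_P_def)
  note gc = gate_count_def base_def
  have n: "dim I \<le> gate_count I" "base I + 7 * dim I + 4 = gate_count I + dim I" by (simp_all add: gc)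
  note len = length_enc_instance[OF met]
  define r1 where "r1 = dim I # r (outs_S I)"
  define r2 where "r2 = r1 @ r (outs_P I)"
  define r3 where "r3 = r2 @ r (outs_V I)"
  have lens: "length r1 = 4 + 3 * gate_count I + dim I" "length r2 = length r1 + 3 + 3 * gate_count I + dim I"
    by (simp_all add: r1_def r2_def len_r outs)
  have 1: "wp B read_layout (\<lambda>t s. t \<le> 40 \<and> emitted I ?inp s) ((\<lambda>_. 0)(1 := length ?inp), mem ?inp)"
    by (rule wp_read_layout[OF met]) (use B in simp_all)
  have 2: "wp B (emit [r_dim]) (\<lambda>t s. t \<le> 3 \<and> emitted I (?inp @ [dim I]) s) (R, M)"
    if em: "emitted I ?inp (R, M)" for R M
    using em B n by (simp add: emitted_Pair envD[OF emitted_env[OF em]])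
  have 3: "wp B (emit_wires start_S) (\<lambda>t s. t \<le> 70 * gate_count I + 200 \<and> emitted I (?inp @ r1) s) (R, M)"
    if em: "emitted I (?inp @ [dim I]) (R, M)" for R M
  proof -
    have "wp B start_S (\<lambda>t s. t \<le> 10 \<and> (emitted I l s \<and> fst s r_wire = base I + dim I + 6)) (R, M)"
      if "emitted I l (R, M)" for l R M
      using that B n len by (simp add: emitted_Pair envD[OF emitted_env[OF that]] start_S_def)
    from wp_emit_wires[OF met em _ this] show ?thesis
      using B n len by (simp add: r1_def r_def outs_S_def)
  qed
  have 4: "wp B (emit_wires start_P) (\<lambda>t s. t \<le> 70 * gate_count I + 200 \<and> emitted I (?inp @ r2) s) (R, M)"
    if em: "emitted I (?inp @ r1) (R, M)" for R M
  proof -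
    have "wp B start_P (\<lambda>t s. t \<le> 10 \<and> (emitted I l s \<and> fst s r_wire = base I + 4 * dim I + 6)) (R, M)"
      if "emitted I l (R, M)" for l R M
      using that B n len by (simp add: emitted_Pair envD[OF emitted_env[OF that]] start_P_def)
    from wp_emit_wires[OF met em _ this] show ?thesis
      using B n len lens by (simp add: r2_def r_def outs_P_def)
  qed
  have 5: "wp B emit_V (\<lambda>t s. t \<le> 70 * gate_count I + 200 \<and> emitted I (?inp @ r3) s) (R, M)"
    if em: "emitted I (?inp @ r2) (R, M)" for R M
    using wp_emit_V[OF met em] B n len lens by (simp add: r3_def r_def)
  have r3: "enc_instance (potential_of I) = r3"
    by (simp add: enc_instance_def potential_of_def r3_def r2_def r1_def r_def)
  have len3: "length r3 = length r2 + 3 + 3 * gate_count I + dim I + 1"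
    by (simp add: r3_def len_r outs_V_def)
  let ?Q = "\<lambda>s. fst s 0 = length ?inp \<and> fst s 1 = length r3 \<and> snd s = mem (?inp @ r3)"
  have 6: "wp B (block [Add 0 r_len r_zero, Sub r_len r_out r_len]) (\<lambda>t s. t \<le> 3 \<and> ?Q s) (R, M)"
    if em: "emitted I (?inp @ r3) (R, M)" for R M
    using em B n len len3 lens by (simp add: emitted_Pair envD[OF emitted_env[OF em]])
  have "wp B reduction_program (\<lambda>t s. t \<le> 210 * gate_count I + 700 \<and> ?Q s) (ram_input ?inp)"
    unfolding reduction_program_def ram_input_eq
    by (rule wp_mono[OF wp_block_Cons[OF 1 wp_block_Cons[OF 2 wp_block_Cons[OF 3
      wp_block_Cons[OF 4 wp_block_Cons[OF 5 wp_block_single[OF 6]]]]]]]) auto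
  then show ?thesis unfolding r3 by (rule wp_mono) (auto intro: ram_output_tail)
qed

lemma wp_solution_program:
  assumes met: "metered_line_instance I" and y: "length y = dim I"
    and B: "length (enc_instance I) + dim I + 1 < B"
  shows "wp B solution_program (\<lambda>t s. t \<le> 6 \<and> ram_output s = enc_bits y)
    (ram_input (enc_instance_bits (I, y)))"
proof -
  let ?inp = "enc_instance I" and ?R = "(\<lambda>_. 0)(1 := length (enc_instance I) + (dim I + 1))"
  have len: "length (enc_bits y) = dim I + 1" using y by (simp add: enc_bits_def)
  have 0: "mem (?inp @ enc_bits y) 0 = dim I" using input_header(1)[OF met] .
  have "wp B solution_program (\<lambda>t s. t \<le> 6 \<and> (fst s 0 = length ?inp \<and> fst s 1 = length (enc_bits y) \<and>
      snd s = mem (?inp @ enc_bits y))) (?R, mem (?inp @ enc_bits y))"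
    using 0 B by (simp add: solution_program_def len)
  then have "wp B solution_program (\<lambda>t s. t \<le> 6 \<and> ram_output s = enc_bits y)
      (?R, mem (?inp @ enc_bits y))"
    by (rule wp_mono) (auto intro: ram_output_tail)
  then show ?thesis
    by (simp add: ram_input_eq enc_instance_bits_def len del: fun_upd_apply)
qed

text \<open>The size is \<open>6 * dim I + 1\<close> plus all gates. Being at least 1, it absorbs
  the additive constants 4 of \<open>gate_count\<close> and 11 of the input length.\<close>

lemma instance_size_bounds:
  assumes "metered_line_instance I"
  shows "gate_count I \<le> 5 * instance_size I" "length (enc_instance I) \<le> 14 * instance_size I"
    "dim I \<le> instance_size I" "1 \<le> instance_size I"
  using num_inputs[OF assms] output_lengths[OF assms]
  by (auto simp: length_enc_instance[OF assms] instance_size_def circuit_size_def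
    gate_count_def off_V_def off_P_def pos_eS_def pos_aP_def pos_eP_def pos_aV_def pos_eV_def)

theorem mainTheorem6:
  shows "\<exists>(f :: line_instance \<Rightarrow> line_instance) (g :: line_instance \<times> bool list \<Rightarrow> bool list).
    linear_time_computable {I. metered_line_instance I} instance_size enc_instance enc_instance f \<and>
    linear_time_computable
      {(I, y). metered_line_instance I \<and> potential_line_solution (f I) y}
      (\<lambda>(I, y). instance_size I) enc_instance_bits enc_bits g \<and>
    (\<forall>I. metered_line_instance I \<longrightarrow>
       potential_line_instance (f I) \<and>
       (\<forall>y. potential_line_solution (f I) y \<longrightarrow> metered_line_solution I (g (I, y))))"
proof (intro exI[of _ potential_of] exI[of _ snd] conjI)
  \<comment> \<open>By the size bounds the time is at most 1050 + 700 = 1750 times the size and the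
    words need at most 14 + 60 + 20 = 94 times the size; one constant has to serve both.\<close>
  have "\<exists>t s. ram_exec (2000 * instance_size I) reduction_program (ram_input (enc_instance I)) t s \<and>
      t \<le> 2000 * instance_size I \<and> ram_output s = enc_instance (potential_of I)"
    if "metered_line_instance I" for I
    using wp_reduction_program[OF that, of "2000 * instance_size I"] instance_size_bounds[OF that]
    unfolding wp_def by fastforce
  then show "linear_time_computable {I. metered_line_instance I} instance_size enc_instance enc_instance
      potential_of"
    unfolding linear_time_computable_def by blast
next
  have "\<exists>t s. ram_exec (100 * instance_size I) solution_program (ram_input (enc_instance_bits (I, y))) t s \<and>
      t \<le> 100 * instance_size I \<and> ram_output s = enc_bits y"
    if met: "metered_line_instance I" and "potential_line_solution (potential_of I) y" for I y
  proof -
    have "length y = dim I"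
      using that(2) by (simp add: potential_line_solution_def potential_of_def)
    from wp_solution_program[OF met this, of "100 * instance_size I"] instance_size_bounds[OF met]
    show ?thesis unfolding wp_def by fastforce
  qed
  then show "linear_time_computable
      {(I, y). metered_line_instance I \<and> potential_line_solution (potential_of I) y}
      (\<lambda>(I, y). instance_size I) enc_instance_bits enc_bits snd"
    unfolding linear_time_computable_def
    by (intro exI[of _ solution_program] exI[of _ 100]) auto
next
  show "\<forall>I. metered_line_instance I \<longrightarrow>
       potential_line_instance (potential_of I) \<and>
       (\<forall>y. potential_line_solution (potential_of I) y \<longrightarrow> metered_line_solution I (snd (I, y)))"
    using potential_line_instance_potential_of metered_line_solution_if_potential by simp
qed

end
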